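(* Let $n\geq m\geq 1$ be integers, let $K$ be a field, $S=K[x_1,\ldots,x_{n+m}]$ and $I=(x_1,\ldots,x_n)\cap(x_{n+1},\ldots,x_{n+m})\subset S$. (1) If $n$ and $m$ are not both even, then $$\operatorname{sdepth}(I)=\operatorname{hdepth}(I)=\left\lceil\frac n2\right\rceil+\left\lceil\frac m2\right\rceil.$$ (2) If $n=2t$ and $m=2s$ (with $t,s$ integers), then $$t+s\leq \operatorname{sdepth}(I)\leq \operatorname{hdepth}(I)\leq t+s+1.$$ In both cases, $\operatorname{hdepth}(I)=\left\lfloor\frac{n+m+2}{2}\right\rfloor$.
   Context: Stanley depth: let $S=K[x_1,\ldots,x_p]$ be a polynomial ring over a field $K$ and $M$ a $\mathbb Z^p$-graded $S$-module. A Stanley decomposition of $M$ is a direct sum decomposition $\mathcal D: M=\bigoplus_{i=1}^r m_iK[Z_i]$ as a $\mathbb Z^p$-graded $K$-vector space, where each $m_i\in M$ is homogeneous with respect to the $\mathbb Z^p$-grading, $Z_i\subset\{x_1,\ldots,x_p\}$, and $m_iK[Z_i]=\{um_i: u\in K[Z_i]\}\subset M$ is a free $K[Z_i]$-submodule. Put $\operatorname{sdepth}(\mathcal D)=\min_i|Z_i|$ and $\operatorname{sdepth}(M)=\max\{\operatorname{sdepth}(\mathcal D):\mathcal D$ a Stanley decomposition of $M\}$. Hilbert depth: for a finitely generated graded $S$-module $M$, $\operatorname{hdepth}(M)$ is the maximal depth of a finitely generated graded $S$-module with the same Hilbert series as $M$. For squarefree monomial ideals $A\subset B\subset S$ this is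 (by a known theorem, usable as the definition) $\operatorname{hdepth}(B/A)=\max\{d\in\{0,\ldots,p\}:\beta_k^d(B/A)\geq 0\text{ for all }0\leq k\leq d\}$, where $\beta_k^d(B/A)=\sum_{j=0}^k(-1)^{k-j}\binom{d-j}{k-j}\alpha_j(B/A)$ and $\alpha_j(B/A)$ is the number of squarefree monomials of degree $j$ in $B\setminus A$ (for the ideal $I$ itself take $B=I$, $A=0$). *)

theory Defs
  imports Complex_Main "HOL-Library.Poly_Mapping" "HOL-Library.FuncSet" "HOL-Algebra.Ideal"
begin

text \<open>
  Polynomials over \<open>'k\<close> in variables indexed by \<open>nat\<close>: a monomial is its exponent vector
  (\<open>nat \<Rightarrow>\<^sub>0 nat\<close>), a polynomial a finitely supported map from monomials to coefficients,
  with the convolution product of \<open>Poly_Mapping\<close>.  Sets of variables are represented by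
  their index sets, so \<open>x\<^sub>1, \<dots>, x\<^sub>p\<close> is \<open>{1..p}\<close>.
\<close>

type_synonym 'k mpoly = "(nat \<Rightarrow>\<^sub>0 nat) \<Rightarrow>\<^sub>0 'k"

definition Var :: "nat \<Rightarrow> 'k::field mpoly" where
  "Var i = Poly_Mapping.single (Poly_Mapping.single i 1) 1"

definition polys_in :: "nat set \<Rightarrow> 'k::field mpoly set" where
  "polys_in Z = {f. \<forall>a\<in>Poly_Mapping.keys f. Poly_Mapping.keys a \<subseteq> Z}"

definition poly_ring :: "nat \<Rightarrow> 'k::field mpoly ring" where
  "poly_ring p =
    \<lparr>carrier = polys_in {1..p}, mult = (*), one = 1, zero = 0, add = (+)\<rparr>"

text \<open>
  Stanley decompositions are stated for \<open>\<int>\<^sup>p\<close>-graded submodules \<open>M\<close> of \<open>S\<close>, i.e. monomial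
  ideals.  The graded pieces of \<open>S\<close> are the lines spanned by single monomials, and those of
  degree outside \<open>\<nat>\<^sup>p\<close> vanish, so degrees are taken in \<open>\<nat>\<^sup>p\<close>.
\<close>

definition homogeneous :: "'k::field mpoly \<Rightarrow> bool" where
  "homogeneous f \<longleftrightarrow> (\<exists>a. Poly_Mapping.keys f \<subseteq> {a})"

definition stanley_space :: "'k::field mpoly \<Rightarrow> nat set \<Rightarrow> 'k mpoly set" where
  "stanley_space g Z = {u * g |u. u \<in> polys_in Z}"

text \<open>
  A decomposition is the list of the pairs \<open>(m\<^sub>i, Z\<^sub>i)\<close>.  The third conjunct in the quantifier
  says that \<open>m\<^sub>i\<close> is a basis of \<open>m\<^sub>i K[Z\<^sub>i]\<close>.  The last conjunct says that the summation map from
  the product of the finitely many spaces \<open>m\<^sub>i K[Z\<^sub>i]\<close> to \<open>M\<close> is a bijection, i.e. that \<open>M\<close> is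
  their internal direct sum; this is automatically compatible with the grading because the
  \<open>m\<^sub>i\<close> are homogeneous.
\<close>

definition stanley_decomposition ::
    "nat \<Rightarrow> 'k::field mpoly set \<Rightarrow> ('k mpoly \<times> nat set) list \<Rightarrow> bool" where
  "stanley_decomposition p M D \<longleftrightarrow>
    (\<forall>(g, Z)\<in>set D. g \<in> M \<and> homogeneous g \<and> (\<forall>u\<in>polys_in Z. u * g = 0 \<longrightarrow> u = 0) \<and>
       Z \<subseteq> {1..p}) \<and>
    bij_betw (\<lambda>h. \<Sum>i<length D. h i)
      (\<Pi>\<^sub>E i\<in>{..<length D}. stanley_space (fst (D ! i)) (snd (D ! i))) M"

text \<open>For \<open>M \<noteq> {0}\<close> a Stanley decomposition is a nonempty list, so the minimum is meaningful.\<close>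

definition sdepth_decomp :: "('k::field mpoly \<times> nat set) list \<Rightarrow> nat" where
  "sdepth_decomp D = Min ((\<lambda>(g, Z). card Z) ` set D)"

definition sdepth :: "nat \<Rightarrow> 'k::field mpoly set \<Rightarrow> nat" where
  "sdepth p M = Max {sdepth_decomp D |D. stanley_decomposition p M D}"

text \<open>
  The Hilbert depth of \<open>B/A\<close>, for squarefree monomial ideals \<open>A \<subset> B\<close> of \<open>S\<close>, is defined by its
  known combinatorial description in terms of the numbers \<open>\<alpha>\<^sub>j(B/A)\<close> and \<open>\<beta>\<^sub>k\<^sup>d(B/A)\<close>.
\<close>

definition squarefree_monomials :: "nat \<Rightarrow> nat \<Rightarrow> 'k::field mpoly set" where
  "squarefree_monomials p j = {\<Prod>i\<in>F. Var i |F. F \<subseteq> {1..p} \<and> card F = j}"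

definition hd_alpha :: "nat \<Rightarrow> 'k::field mpoly set \<Rightarrow> 'k mpoly set \<Rightarrow> nat \<Rightarrow> nat" where
  "hd_alpha p B A j = card (squarefree_monomials p j \<inter> (B - A))"

definition hd_beta :: "nat \<Rightarrow> 'k::field mpoly set \<Rightarrow> 'k mpoly set \<Rightarrow> nat \<Rightarrow> nat \<Rightarrow> int" where
  "hd_beta p B A d k =
    (\<Sum>j=0..k. (- 1) ^ (k - j) * int ((d - j) choose (k - j)) * int (hd_alpha p B A j))"

definition hdepth :: "nat \<Rightarrow> 'k::field mpoly set \<Rightarrow> 'k mpoly set \<Rightarrow> nat" where
  "hdepth p B A = Max {d. d \<le> p \<and> (\<forall>k\<le>d. 0 \<le> hd_beta p B A d k)}"

end

theory Submission
  imports Defs "HOL-Library.Disjoint_Sets"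
begin

text \<open>
  Restricting a Stanley decomposition of a squarefree monomial ideal to the squarefree monomials
  partitions the supports of these monomials into intervals \<open>[X, Y]\<close> with \<open>|Y|\<close> at least the
  depth \<open>d\<close> of the decomposition.  The contribution of an interval to \<open>\<beta>\<^sub>k\<^sup>d\<close> is the coefficient
  of \<open>u\<^sup>k\<close> in \<open>u\<^bsup>|X|\<^esup> (1 - u)\<^bsup>d - |Y|\<^esup>\<close>, which is nonnegative, so the Stanley depth is at most the
  Hilbert depth.  Conversely, every interval partition of the supports of the ideal is
  induced by a Stanley decomposition.

  For \<open>n\<close> odd, the nonempty subsets \<open>S\<close> of \<open>\<int>/n\<close> are partitioned as follows.  The cyclic recursion
  \<open>p + 1 \<in> R \<longleftrightarrow> p \<in> S \<or> p \<notin> R\<close> has exactly one solution \<open>R\<close>, since its right-hand side is constant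
  at each \<open>p \<in> S\<close>.  The sets \<open>S\<close> with a given solution \<open>R\<close> form an interval: membership in \<open>S\<close> is
  prescribed on \<open>R\<close> and free outside \<open>R\<close>.  The points of \<open>R\<close> excluded from \<open>S\<close> are those
  followed by a free point, so there are at most \<open>(n - 1) / 2\<close> of them.  Products of such
  partitions give the lower bound for the Stanley depth.

  The coefficient \<open>\<beta>\<^sub>k\<^sup>d\<close> of the ideal is a mixed second difference of \<open>a \<mapsto> (a - d + k - 1 choose k)\<close>.  Its
  value at \<open>k = 3\<close> is \<open>n m (n + m + 2 - 2 d) / 2\<close>, which bounds the Hilbert depth from above.
\<close>

section \<open>Interval partitions\<close>

text \<open>An interval is recorded by its end points. Since \<open>X \<subseteq> Y\<close> makes it
  nonempty, it determines them, so uniqueness of the pair amounts to disjointness of the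
  intervals.\<close>

definition interval_partition :: "('a set \<times> 'a set) set \<Rightarrow> 'a set set \<Rightarrow> bool" where
  "interval_partition P \<S> \<longleftrightarrow>
    (\<forall>(X, Y)\<in>P. X \<subseteq> Y \<and> {X..Y} \<subseteq> \<S>) \<and> (\<forall>S\<in>\<S>. \<exists>!I. I \<in> P \<and> S \<in> {fst I..snd I})"

lemma interval_partitionD:
  assumes "interval_partition P \<S>" "(X, Y) \<in> P"
  shows "X \<subseteq> Y" "{X..Y} \<subseteq> \<S>" "Y \<in> \<S>"
proof -
  show 1: "X \<subseteq> Y" and 2: "{X..Y} \<subseteq> \<S>"
    using assms unfolding interval_partition_def by blast+
  show "Y \<in> \<S>" using 2 by (rule subsetD) (simp add: 1)
qed

lemma interval_partitionE:
  assumes "interval_partition P \<S>" "S \<in> \<S>"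
  obtains X Y where "(X, Y) \<in> P" "S \<in> {X..Y}"
    "\<And>X' Y'. (X', Y') \<in> P \<Longrightarrow> S \<in> {X'..Y'} \<Longrightarrow> X' = X \<and> Y' = Y"
proof -
  have "\<exists>!I. I \<in> P \<and> S \<in> {fst I..snd I}"
    using assms unfolding interval_partition_def by blast
  then obtain I where I: "I \<in> P" "S \<in> {fst I..snd I}"
    and uniq: "\<And>J. J \<in> P \<Longrightarrow> S \<in> {fst J..snd J} \<Longrightarrow> J = I" by (elim ex1E) blast
  show thesis
  proof (rule that[of "fst I" "snd I"])
    fix X' Y' assume "(X', Y') \<in> P" "S \<in> {X'..Y'}"
    then have "(X', Y') = I" by (intro uniq) simp_all
    then show "X' = fst I \<and> Y' = snd I" by auto
  qed (use I in simp_all)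
qed

section \<open>The cyclic recursion and the nonempty subsets of an odd cycle\<close>

lemma cyclic_solution_unique:
  fixes S R R' :: "nat set"
  assumes a: "a \<in> S" "a < n" and R: "R \<subseteq> {..<n}" "R' \<subseteq> {..<n}"
    and rec: "\<And>p. p < n \<Longrightarrow> Suc p mod n \<in> R \<longleftrightarrow> p \<in> S \<or> p \<notin> R"
    and rec': "\<And>p. p < n \<Longrightarrow> Suc p mod n \<in> R' \<longleftrightarrow> p \<in> S \<or> p \<notin> R'"
  shows "R = R'"
proof -
  \<comment> \<open>Both solutions contain the successor of \<open>a\<close>, and from there the
    recursion fixes one point after the other around the cycle.\<close>
  have *: "(Suc a + i) mod n \<in> R \<longleftrightarrow> (Suc a + i) mod n \<in> R'" for i
  proof (induction i)
    case 0
    then show ?case using a rec rec' by simp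
  next
    case (Suc i)
    have "(Suc a + i) mod n < n" using a by simp
    from rec[OF this] rec'[OF this] Suc show ?case
      by (simp add: mod_Suc_eq)
  qed
  have "p \<in> R \<longleftrightarrow> p \<in> R'" if "p < n" for p
  proof -
    \<comment> \<open>From the successor of \<open>a\<close> it takes \<open>p + n - Suc a\<close>
      steps to come to \<open>p\<close>; the summand \<open>n\<close> keeps the subtraction from
      truncating.\<close>
    have "(Suc a + (p + n - Suc a)) mod n = p" using that a by simp
    then show ?thesis using *[of "p + n - Suc a"] by simp
  qed
  then show ?thesis using R by blast
qed

text \<open>The recursion is run along the naturals from an initial value \<open>b\<close>. Past
  \<open>a\<close> the run has forgotten \<open>b\<close>, so restarting with the value
  \<open>c\<close> reached at \<open>n\<close> gives a run that returns to \<open>c\<close> at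
  \<open>n\<close> and hence closes up to a cyclic solution.\<close>

lemma cyclic_solution_exists:
  fixes S :: "nat set"
  assumes a: "a \<in> S" "a < n"
  obtains R where "R \<subseteq> {..<n}" "\<And>p. p < n \<Longrightarrow> Suc p mod n \<in> R \<longleftrightarrow> p \<in> S \<or> p \<notin> R"
proof -
  define f :: "bool \<Rightarrow> nat \<Rightarrow> bool" where "f b = rec_nat b (\<lambda>p r. p \<in> S \<or> \<not> r)" for b
  have f0: "f b 0 = b" and fS: "f b (Suc p) \<longleftrightarrow> p \<in> S \<or> \<not> f b p" for b p
    by (simp_all add: f_def)
  have indep: "f b (Suc a + i) = f b' (Suc a + i)" for b b' i
    using a by (induction i) (simp_all add: fS)
  define c where "c = f True n"
  have c: "f c n = c"
    using indep[of c "n - Suc a" True] a by (simp add: c_def)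
  show thesis
  proof (rule that[of "{p. p < n \<and> f c p}"])
    fix p assume p: "p < n"
    show "Suc p mod n \<in> {p. p < n \<and> f c p} \<longleftrightarrow> p \<in> S \<or> p \<notin> {p. p < n \<and> f c p}"
    proof (cases "Suc p = n")
      case True
      then show ?thesis using p c fS[of c p] f0[of c] by auto
    next
      case False
      then show ?thesis using p fS[of c p] by simp
    qed
  qed auto
qed

lemma nonempty_interval_partition_odd:
  assumes "odd n"
  shows "\<exists>P. interval_partition P (Pow {..<n} - {{}}) \<and> (\<forall>(X, Y)\<in>P. n \<le> 2 * card Y)"
proof -
  \<comment> \<open>A point outside \<open>R\<close> forces its successor into \<open>R\<close>,
    which is the condition \<open>V R\<close>. For a point of \<open>R\<close> the recursion decides
    membership in \<open>S\<close>: those in \<open>X R\<close> must belong to \<open>S\<close>,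
    those in \<open>O' R\<close> must not. Outside \<open>R\<close> membership is free, so the cell
    of \<open>R\<close> runs from \<open>X R\<close> to \<open>Y R\<close>.\<close>
  define V where "V R \<longleftrightarrow> R \<subseteq> {..<n} \<and> (\<forall>p<n. p \<notin> R \<longrightarrow> Suc p mod n \<in> R)" for R
  define X where "X R = {p \<in> R. Suc p mod n \<in> R}" for R
  define O' where "O' R = {p \<in> R. Suc p mod n \<notin> R}" for R
  define Y where "Y R = {..<n} - O' R" for R
  have n: "n > 0" using assms by (auto intro: Nat.gr0I)
  \<comment> \<open>Lying in the cell of \<open>R\<close> means solving the recursion with
    \<open>R\<close>. Existence and uniqueness of the solution thus become the partition
    property.\<close>
  have cell: "V R \<and> S \<in> {X R..Y R} \<longleftrightarrow>
      R \<subseteq> {..<n} \<and> S \<subseteq> {..<n} \<and> (\<forall>p<n. Suc p mod n \<in> R \<longleftrightarrow> p \<in> S \<or> p \<notin> R)" for R S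
    unfolding V_def X_def O'_def Y_def atLeastAtMost_iff by blast
  have XY: "X R \<subseteq> Y R" if "V R" for R
    using that by (auto simp: V_def X_def Y_def O'_def)
  \<comment> \<open>Were \<open>X R\<close> empty, membership in \<open>R\<close> would alternate
    around a cycle of odd length. So the empty set lies in no cell.\<close>
  have Xne: "X R \<noteq> {}" if "V R" for R
  proof
    assume "X R = {}"
    then have alt: "Suc p mod n \<in> R \<longleftrightarrow> p \<notin> R" if "p < n" for p
      using that \<open>V R\<close> by (auto simp: V_def X_def)
    have "p < n \<Longrightarrow> p \<in> R \<longleftrightarrow> (even p \<longleftrightarrow> 0 \<in> R)" for p
    proof (induction p)
      case (Suc p)
      then show ?case using alt[of p] by auto
    qed simp
    from this[of "n - 1"] alt[of "n - 1"] n assms show False by auto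
  qed
  have Ycard: "n \<le> 2 * card (Y R)" if "V R" for R
  proof -
    have fin: "finite R" "R \<subseteq> {..<n}" using that finite_subset by (auto simp: V_def)
    \<comment> \<open>The predecessor of a point outside \<open>R\<close> lies in \<open>R\<close>
      by \<open>V R\<close>, hence in \<open>O' R\<close>. So the successor map is a bijection from
      \<open>O' R\<close> to the complement of \<open>R\<close>, which gives n = 2 |O' R| + |X R|
      and 2 |Y R| = n + |X R|.\<close>
    have img: "(\<lambda>p. Suc p mod n) ` O' R = {..<n} - R"
    proof
      show "(\<lambda>p. Suc p mod n) ` O' R \<subseteq> {..<n} - R" using n by (auto simp: O'_def)
      show "{..<n} - R \<subseteq> (\<lambda>p. Suc p mod n) ` O' R"
      proof
        fix q assume q: "q \<in> {..<n} - R"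
        define p where "p = (if q = 0 then n - 1 else q - 1)"
        have p: "p < n" "Suc p mod n = q" using q n by (auto simp: p_def)
        then have "p \<in> O' R" using q that by (auto simp: V_def O'_def)
        then show "q \<in> (\<lambda>p. Suc p mod n) ` O' R" using p by blast
      qed
    qed
    have "inj_on (\<lambda>p. Suc p mod n) {..<n}"
      by (rule inj_onI) (auto simp: mod_Suc split: if_splits)
    then have "inj_on (\<lambda>p. Suc p mod n) (O' R)"
      by (rule inj_on_subset) (use fin in \<open>auto simp: O'_def\<close>)
    then have 1: "card (O' R) = n - card R"
      using card_image[of _ "O' R"] img fin by (metis card_Diff_subset card_lessThan)
    have 2: "card R = card (O' R) + card (X R)"
      using fin by (subst card_Un_disjoint[symmetric]) (auto simp: O'_def X_def intro!: arg_cong[of _ _ card])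
    have "O' R \<subseteq> {..<n}" using fin by (auto simp: O'_def)
    then have 3: "card (Y R) = n - card (O' R)"
      unfolding Y_def by (subst card_Diff_subset) (auto intro: finite_subset)
    have "card R \<le> n" using card_mono[OF _ fin(2)] by simp
    with 1 2 3 show ?thesis by simp
  qed
  let ?P = "(\<lambda>R. (X R, Y R)) ` {R. V R}"
  have "interval_partition ?P (Pow {..<n} - {{}})"
    unfolding interval_partition_def
  proof (intro conjI ballI)
    fix I assume "I \<in> ?P"
    then obtain R where R: "V R" "I = (X R, Y R)" by auto
    have "Y R \<subseteq> {..<n}" by (auto simp: Y_def)
    moreover have "{X R..Y R} \<subseteq> Pow {..<n} - {{}}"
      using \<open>Y R \<subseteq> {..<n}\<close> Xne[OF R(1)] unfolding subset_iff atLeastAtMost_iff by blast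
    ultimately show "case I of (X, Y) \<Rightarrow> X \<subseteq> Y \<and> {X..Y} \<subseteq> Pow {..<n} - {{}}"
      using R XY by simp
  next
    fix S :: "nat set" assume S: "S \<in> Pow {..<n} - {{}}"
    then obtain a where a: "a \<in> S" "a < n" by auto
    obtain R where R: "R \<subseteq> {..<n}" "\<And>p. p < n \<Longrightarrow> Suc p mod n \<in> R \<longleftrightarrow> p \<in> S \<or> p \<notin> R"
      using cyclic_solution_exists[OF a] by metis
    have R': "V R \<and> S \<in> {X R..Y R}" using cell R S by blast
    show "\<exists>!I. I \<in> ?P \<and> S \<in> {fst I..snd I}"
    proof (rule ex1I[of _ "(X R, Y R)"])
      fix I assume "I \<in> ?P \<and> S \<in> {fst I..snd I}"
      then obtain R1 where R1: "V R1 \<and> S \<in> {X R1..Y R1}" "I = (X R1, Y R1)" by auto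
      then have "R1 = R" using cell[of R1 S] R
        by (intro cyclic_solution_unique[OF a]) auto
      then show "I = (X R, Y R)" using R1 by simp
    qed (use R' in auto)
  qed
  then show ?thesis using Ycard by blast
qed

text \<open>Carries a partition from \<open>{..<n}\<close> to an arbitrary block of variables.
  Injectivity of \<open>f\<close> on \<open>V\<close> makes inclusion of images equivalent to
  inclusion of subsets of \<open>V\<close>, so intervals go to intervals.\<close>

lemma interval_partition_image:
  assumes P: "interval_partition P \<S>" and f: "inj_on f V" and V: "\<Union>\<S> \<subseteq> V"
    and conv: "\<Union>(fst ` P \<union> snd ` P) \<subseteq> V"
  shows "interval_partition ((\<lambda>(X, Y). (f ` X, f ` Y)) ` P) ((`) f ` \<S>)"
proof -
  have le: "f ` A \<subseteq> f ` B \<longleftrightarrow> A \<subseteq> B" if "A \<subseteq> V" "B \<subseteq> V" for A B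
    using inj_on_image_mem_iff[OF f] that by blast
  have sub: "X \<subseteq> V" "Y \<subseteq> V" if "(X, Y) \<in> P" for X Y
    using conv that by force+
  show ?thesis
    unfolding interval_partition_def
  proof (intro conjI ballI)
    fix I assume "I \<in> (\<lambda>(X, Y). (f ` X, f ` Y)) ` P"
    then obtain X Y where XY: "(X, Y) \<in> P" "I = (f ` X, f ` Y)" by auto
    then have *: "X \<subseteq> Y" "{X..Y} \<subseteq> \<S>" using P by (auto simp: interval_partition_def)
    have "T \<in> (`) f ` \<S>" if T: "f ` X \<subseteq> T" "T \<subseteq> f ` Y" for T
    proof -
      obtain S where S: "S \<subseteq> Y" "T = f ` S" using T(2) by (meson subset_imageE)
      then have "X \<subseteq> S" using T le[of X S] sub[OF XY(1)] by blast
      then have "S \<in> \<S>" using S(1) *(2) by auto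
      then show ?thesis using S(2) by blast
    qed
    then show "case I of (X, Y) \<Rightarrow> X \<subseteq> Y \<and> {X..Y} \<subseteq> (`) f ` \<S>"
      using XY * by auto
  next
    fix T assume "T \<in> (`) f ` \<S>"
    then obtain S where S: "S \<in> \<S>" "T = f ` S" by auto
    then have SV: "S \<subseteq> V" using V by auto
    obtain X Y where XY: "(X, Y) \<in> P" "S \<in> {X..Y}"
      and uniq: "\<And>X' Y'. (X', Y') \<in> P \<Longrightarrow> S \<in> {X'..Y'} \<Longrightarrow> X' = X \<and> Y' = Y"
      by (rule interval_partitionE[OF P S(1)]) blast
    show "\<exists>!J. J \<in> (\<lambda>(X, Y). (f ` X, f ` Y)) ` P \<and> T \<in> {fst J..snd J}"
    proof (rule ex1I[of _ "(f ` X, f ` Y)"])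
      fix J assume "J \<in> (\<lambda>(X, Y). (f ` X, f ` Y)) ` P \<and> T \<in> {fst J..snd J}"
      then obtain X' Y' where *: "(X', Y') \<in> P" "J = (f ` X', f ` Y')" "T \<in> {f ` X'..f ` Y'}" by auto
      then have "S \<in> {X'..Y'}" using le[of X' S] le[of S Y'] sub[OF *(1)] SV S(2) by simp
      then show "J = (f ` X, f ` Y)" using uniq[OF *(1)] *(2) by simp
    next
      have "T \<in> {f ` X..f ` Y}" using XY(2) S(2) by (simp add: image_mono)
      then show "(f ` X, f ` Y) \<in> (\<lambda>(X, Y). (f ` X, f ` Y)) ` P \<and>
          T \<in> {fst (f ` X, f ` Y)..snd (f ` X, f ` Y)}"
        using XY(1) by force
    qed
  qed
qed

lemma interval_partition_insert:
  assumes P: "interval_partition P \<S>" and X: "X \<subseteq> Y" and disj: "\<S> \<inter> {X..Y} = {}"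
  shows "interval_partition (insert (X, Y) P) (\<S> \<union> {X..Y})"
  unfolding interval_partition_def
proof (intro conjI ballI)
  fix I assume "I \<in> insert (X, Y) P"
  moreover have "case I of (A, B) \<Rightarrow> A \<subseteq> B \<and> {A..B} \<subseteq> \<S>" if "I \<in> P"
    using P that unfolding interval_partition_def by blast
  ultimately show "case I of (A, B) \<Rightarrow> A \<subseteq> B \<and> {A..B} \<subseteq> \<S> \<union> {X..Y}"
    using X by (cases I) blast
next
  fix S assume S: "S \<in> \<S> \<union> {X..Y}"
  have sub: "{fst I..snd I} \<subseteq> \<S>" if "I \<in> P" for I
    using P that unfolding interval_partition_def split_beta by blast
  show "\<exists>!I. I \<in> insert (X, Y) P \<and> S \<in> {fst I..snd I}"
  proof (cases "S \<in> \<S>")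
    case True
    then have "\<exists>!I. I \<in> P \<and> S \<in> {fst I..snd I}"
      using P by (auto simp: interval_partition_def)
    moreover have "S \<notin> {X..Y}" using True disj by blast
    ultimately show ?thesis by (metis fst_conv insert_iff snd_conv)
  next
    case False
    then have "S \<in> {X..Y}" using S by blast
    moreover have "S \<notin> {fst I..snd I}" if "I \<in> P" for I using sub[OF that] False by blast
    ultimately show ?thesis by (intro ex1I[of _ "(X, Y)"]) (simp, blast)
  qed
qed

text \<open>An enumeration of \<open>V\<close> transports the odd case. For even positive
  cardinality one element \<open>v\<close> is split off: the subsets containing \<open>v\<close>
  form the single interval from \<open>{v}\<close> to \<open>V\<close>, and the odd case partitions
  the others.\<close>

lemma nonempty_interval_partition:
  assumes "finite V"
  obtains P where "interval_partition P (Pow V - {{}})" "\<And>X Y. (X, Y) \<in> P \<Longrightarrow> card V \<le> 2 * card Y"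
proof -
  have odd_case: "\<exists>P. interval_partition P (Pow V - {{}}) \<and> (\<forall>(X, Y)\<in>P. card V \<le> 2 * card Y)"
    if fin: "finite V" and odd: "odd (card V)" for V :: "'a set"
  proof -
    obtain f where f: "bij_betw f {..<card V} V"
      using ex_bij_betw_nat_finite[OF fin] by (auto simp: atLeast0LessThan)
    obtain P where P: "interval_partition P (Pow {..<card V} - {{}})"
        "\<forall>(X, Y)\<in>P. card V \<le> 2 * card Y"
      using nonempty_interval_partition_odd[OF odd] by blast
    have sub: "X \<subseteq> Y \<and> Y \<subseteq> {..<card V}" if "(X, Y) \<in> P" for X Y
      using interval_partitionD[OF P(1) that] by blast
    have "interval_partition ((\<lambda>(X, Y). (f ` X, f ` Y)) ` P) ((`) f ` (Pow {..<card V} - {{}}))"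
    proof (rule interval_partition_image[OF P(1)])
      show "inj_on f {..<card V}" using f by (rule bij_betw_imp_inj_on)
      show "\<Union>(fst ` P \<union> snd ` P) \<subseteq> {..<card V}" using sub by force
    qed auto
    moreover have "(`) f ` (Pow {..<card V} - {{}}) = Pow V - {{}}"
    proof -
      have "(`) f ` Pow {..<card V} = Pow V"
        using f by (simp add: bij_betw_def image_Pow_surj)
      moreover have "(`) f ` (Pow {..<card V} - {{}}) = (`) f ` Pow {..<card V} - {{}}" by blast
      ultimately show ?thesis by simp
    qed
    moreover have "card V \<le> 2 * card (f ` Y)" if "(X, Y) \<in> P" for X Y
    proof -
      have "inj_on f Y" using sub[OF that] f by (meson bij_betw_imp_inj_on inj_on_subset)
      then show ?thesis using P(2) that by (auto simp: card_image)
    qed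
    ultimately show ?thesis
      by (intro exI[of _ "(\<lambda>(X, Y). (f ` X, f ` Y)) ` P"]) auto
  qed
  have "\<exists>P. interval_partition P (Pow V - {{}}) \<and> (\<forall>(X, Y)\<in>P. card V \<le> 2 * card Y)"
  proof (cases "odd (card V) \<or> V = {}")
    case True
    then show ?thesis
    proof
      assume "V = {}"
      then have "interval_partition {} (Pow V - {{}})" by (simp add: interval_partition_def)
      then show ?thesis by blast
    qed (use odd_case assms in blast)
  next
    case False
    then obtain v where v: "v \<in> V" by auto
    have c: "card V = Suc (card (V - {v}))" using v assms by (metis card.remove)
    then have "odd (card (V - {v}))" using False by auto
    then obtain P where P: "interval_partition P (Pow (V - {v}) - {{}})"
        "\<forall>(X, Y)\<in>P. card (V - {v}) \<le> 2 * card Y"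
      using odd_case[of "V - {v}"] assms by blast
    have "interval_partition (insert ({v}, V) P) ((Pow (V - {v}) - {{}}) \<union> {{v}..V})"
      using v by (intro interval_partition_insert[OF P(1)]) auto
    moreover have "(Pow (V - {v}) - {{}}) \<union> {{v}..V} = Pow V - {{}}" using v by auto
    moreover have "card V \<le> 2 * card Y" if "(X, Y) \<in> P" for X Y
    proof -
      have "card (V - {v}) \<le> 2 * card Y" using P(2) that by auto
      \<comment> \<open>Parity makes the bound for \<open>V - {v}\<close> strict, which gains the
        one missing element.\<close>
      moreover have "card (V - {v}) \<noteq> 2 * card Y" using \<open>odd (card (V - {v}))\<close> by auto
      ultimately show ?thesis using c by simp
    qed
    ultimately show ?thesis by (intro exI[of _ "insert ({v}, V) P"]) auto
  qed
  then show thesis using that by blast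
qed

text \<open>For disjoint \<open>A\<close> and \<open>B\<close> a subset of the union is the same as
  a pair of traces, and inclusion is checked on each trace. A product of intervals is therefore an
  interval, and the sizes of the upper ends add.\<close>

lemma interval_partition_product:
  assumes P: "interval_partition P \<S>" and Q: "interval_partition Q \<T>"
    and A: "\<S> \<subseteq> Pow A" and B: "\<T> \<subseteq> Pow B" and disj: "A \<inter> B = {}"
  shows "interval_partition ((\<lambda>((X, Y), (X', Y')). (X \<union> X', Y \<union> Y')) ` (P \<times> Q))
    {S. S \<subseteq> A \<union> B \<and> S \<inter> A \<in> \<S> \<and> S \<inter> B \<in> \<T>}"
proof -
  have subP: "X \<subseteq> Y \<and> Y \<subseteq> A \<and> {X..Y} \<subseteq> \<S>" if "(X, Y) \<in> P" for X Y
    using interval_partitionD[OF P that] A by blast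
  have subQ: "X \<subseteq> Y \<and> Y \<subseteq> B \<and> {X..Y} \<subseteq> \<T>" if "(X, Y) \<in> Q" for X Y
    using interval_partitionD[OF Q that] B by blast
  have mem: "S \<in> {X \<union> X'..Y \<union> Y'} \<longleftrightarrow> S \<subseteq> A \<union> B \<and> S \<inter> A \<in> {X..Y} \<and> S \<inter> B \<in> {X'..Y'}"
    if "(X, Y) \<in> P" "(X', Y') \<in> Q" for S X Y X' Y'
    using subP[OF that(1)] subQ[OF that(2)] disj unfolding atLeastAtMost_iff by blast
  let ?R = "(\<lambda>((X, Y), (X', Y')). (X \<union> X', Y \<union> Y')) ` (P \<times> Q)"
  show ?thesis
    unfolding interval_partition_def
  proof (intro conjI ballI)
    fix I assume "I \<in> ?R"
    then obtain X Y X' Y' where I: "(X, Y) \<in> P" "(X', Y') \<in> Q" "I = (X \<union> X', Y \<union> Y')" by auto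
    have "{X \<union> X'..Y \<union> Y'} \<subseteq> {S. S \<subseteq> A \<union> B \<and> S \<inter> A \<in> \<S> \<and> S \<inter> B \<in> \<T>}"
      using mem[OF I(1,2)] subP[OF I(1)] subQ[OF I(2)] by blast
    moreover have "X \<union> X' \<subseteq> Y \<union> Y'" using subP[OF I(1)] subQ[OF I(2)] by blast
    ultimately show "case I of (X, Y) \<Rightarrow> X \<subseteq> Y \<and> {X..Y} \<subseteq> {S. S \<subseteq> A \<union> B \<and> S \<inter> A \<in> \<S> \<and> S \<inter> B \<in> \<T>}"
      using I(3) by simp
  next
    fix S assume "S \<in> {S. S \<subseteq> A \<union> B \<and> S \<inter> A \<in> \<S> \<and> S \<inter> B \<in> \<T>}"
    then have S: "S \<subseteq> A \<union> B" "S \<inter> A \<in> \<S>" "S \<inter> B \<in> \<T>" by auto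
    obtain X Y where 1: "(X, Y) \<in> P" "S \<inter> A \<in> {X..Y}"
      and u: "\<And>C D. (C, D) \<in> P \<Longrightarrow> S \<inter> A \<in> {C..D} \<Longrightarrow> C = X \<and> D = Y"
      by (rule interval_partitionE[OF P S(2)]) blast
    obtain X' Y' where 3: "(X', Y') \<in> Q" "S \<inter> B \<in> {X'..Y'}"
      and u': "\<And>C D. (C, D) \<in> Q \<Longrightarrow> S \<inter> B \<in> {C..D} \<Longrightarrow> C = X' \<and> D = Y'"
      by (rule interval_partitionE[OF Q S(3)]) blast
    show "\<exists>!I. I \<in> ?R \<and> S \<in> {fst I..snd I}"
    proof (rule ex1I[of _ "(X \<union> X', Y \<union> Y')"])
      show "(X \<union> X', Y \<union> Y') \<in> ?R \<and> S \<in> {fst (X \<union> X', Y \<union> Y')..snd (X \<union> X', Y \<union> Y')}"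
        using 1 3 mem[OF 1(1) 3(1), of S] S(1)
        by (auto intro!: image_eqI[of _ _ "((X, Y), (X', Y'))"])
    next
      fix I assume I: "I \<in> ?R \<and> S \<in> {fst I..snd I}"
      then obtain C D C' D' where
        2: "(C, D) \<in> P" "(C', D') \<in> Q" "I = (C \<union> C', D \<union> D')" by auto
      have "S \<inter> A \<in> {C..D} \<and> S \<inter> B \<in> {C'..D'}"
        using mem[OF 2(1,2), of S] I 2(3) by simp
      then show "I = (X \<union> X', Y \<union> Y')"
        using u[OF 2(1)] u'[OF 2(2)] 2(3) by simp
    qed
  qed
qed

section \<open>Alternating sums of binomial coefficients\<close>

text \<open>Upper negation turns the signed coefficient into C(k-d-1, k-j), so this is Vandermonde's
  convolution. The generalized binomial is needed because the resulting upper argument may be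
  negative. The proof is an induction on \<open>a\<close> by Pascal's rule.\<close>

lemma alternating_binomial_sum:
  assumes "k \<le> d"
  shows "(\<Sum>j=0..k. (- 1) ^ (k - j) * of_nat ((d - j) choose (k - j)) * of_nat (a choose j)) =
    ((of_nat a - of_nat d + of_nat k - 1 :: 'a :: field_char_0) gchoose k)"
  using assms
proof (induction a arbitrary: d k)
  case 0
  have "(\<Sum>j=0..k. (- 1) ^ (k - j) * of_nat ((d - j) choose (k - j)) * of_nat (0 choose j) :: 'a) =
      (\<Sum>j=0..k. if j = 0 then (- 1) ^ k * of_nat (d choose k) else 0)"
    by (intro sum.cong) (auto simp: binomial_eq_0)
  also have "\<dots> = (- 1) ^ k * of_nat (d choose k)" by simp
  also have "\<dots> = (of_nat 0 - of_nat d + of_nat k - 1) gchoose k"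
    using gbinomial_negated_upper[of "of_nat d :: 'a" k] gbinomial_negated_upper[of "of_nat k - of_nat d - 1 :: 'a" k]
    by (simp add: binomial_gbinomial algebra_simps)
  finally show ?case .
next
  case (Suc a)
  show ?case
  proof (cases k)
    case 0
    then show ?thesis by simp
  next
    case k: (Suc k')
    then obtain d' where d: "d = Suc d'" using Suc.prems by (cases d) auto
    let ?c = "\<lambda>d k j. (- 1) ^ (k - j) * of_nat ((d - j) choose (k - j)) :: 'a"
    have "(\<Sum>j=0..k. ?c d k j * of_nat (Suc a choose j)) =
        ?c d k 0 + (\<Sum>j=0..k'. ?c d k (Suc j) * of_nat (Suc a choose Suc j))"
      unfolding k sum.atLeast0_atMost_Suc_shift by simp
    \<comment> \<open>Pascal's rule splits each term: one half rejoins the term j = 0 to give the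
      sum for \<open>a\<close> with the same \<open>d\<close> and \<open>k\<close>, the other half
      is the sum for \<open>a\<close> with both lowered by one.\<close>
    also have "\<dots> = (?c d k 0 + (\<Sum>j=0..k'. ?c d k (Suc j) * of_nat (a choose Suc j))) +
        (\<Sum>j=0..k'. ?c d' k' j * of_nat (a choose j))"
      by (simp add: k d sum.distrib[symmetric] algebra_simps)
    also have "?c d k 0 + (\<Sum>j=0..k'. ?c d k (Suc j) * of_nat (a choose Suc j)) =
        (\<Sum>j=0..k. ?c d k j * of_nat (a choose j))"
      unfolding k sum.atLeast0_atMost_Suc_shift by simp
    also have "\<dots> = (of_nat a - of_nat d + of_nat k - 1) gchoose k"
      using Suc by blast
    also have "(\<Sum>j=0..k'. ?c d' k' j * of_nat (a choose j)) =
        (of_nat a - of_nat d' + of_nat k' - 1) gchoose k'"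
      using Suc k d by (intro Suc.IH) simp
    finally show ?thesis
      using gbinomial_Suc_Suc[of "of_nat a - of_nat d + of_nat k - 1 :: 'a" k']
      by (simp add: k d algebra_simps)
  qed
qed

lemma gbinomial_of_int_nonneg:
  assumes "0 \<le> x"
  shows "0 \<le> ((of_int x + of_nat k - 1 :: 'a :: linordered_field) gchoose k)"
proof (cases k)
  case (Suc k')
  have "of_int x + of_nat k - 1 = (of_nat (nat x + k') :: 'a)"
    using assms by (simp add: Suc)
  then show ?thesis by (metis binomial_gbinomial of_nat_0_le_iff)
qed simp

text \<open>An interval between sets of sizes \<open>f\<close> and \<open>g\<close> has C(g-f, j-f)
  members of size \<open>j\<close>. Shifting \<open>j\<close> by \<open>f\<close> evaluates the sum
  to C((g-d)+(k-f)-1, k-f), and d \<le> g makes this nonnegative. For f > k every term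
  vanishes.\<close>

lemma alternating_binomial_sum_interval_nonneg:
  assumes "k \<le> d" "d \<le> g" "f \<le> g"
  shows "0 \<le> (\<Sum>j=0..k. (- 1) ^ (k - j) * int ((d - j) choose (k - j)) *
    (if f \<le> j then int ((g - f) choose (j - f)) else 0))"
proof (cases "f \<le> k")
  case True
  have "(\<Sum>j=0..k. (- 1) ^ (k - j) * int ((d - j) choose (k - j)) *
      (if f \<le> j then int ((g - f) choose (j - f)) else 0)) =
      (\<Sum>j=f..k. (- 1) ^ (k - j) * int ((d - j) choose (k - j)) * int ((g - f) choose (j - f)))"
    by (intro sum.mono_neutral_cong_right) auto
  also have "\<dots> = (\<Sum>j=0..k-f. (- 1) ^ (k - f - j) * int ((d - f - j) choose (k - f - j)) * int ((g - f) choose j))"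
    using True by (intro sum.reindex_bij_witness[of _ "\<lambda>j. j + f" "\<lambda>j. j - f"]) auto
  finally have eq: "(\<Sum>j=0..k. (- 1) ^ (k - j) * int ((d - j) choose (k - j)) *
      (if f \<le> j then int ((g - f) choose (j - f)) else 0)) = \<dots>" .
  have "real_of_int (\<Sum>j=0..k-f. (- 1) ^ (k - f - j) * int ((d - f - j) choose (k - f - j)) * int ((g - f) choose j)) =
     (real (g - f) - real (d - f) + real (k - f) - 1) gchoose (k - f)"
    using assms by (subst alternating_binomial_sum[symmetric]) simp_all
  also have "real (g - f) - real (d - f) = of_int (int g - int d)"
    using assms True by (simp add: of_nat_diff)
  also have "0 \<le> (\<dots> + real (k - f) - 1) gchoose (k - f)"
    using assms by (intro gbinomial_of_int_nonneg) auto
  finally show ?thesis using eq by linarith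
next
  case False
  then show ?thesis by (intro sum_nonneg) auto
qed

lemma gbinomial_3: "(x gchoose 3 :: 'a :: field_char_0) = x * (x - 1) * (x - 2) / 6"
  by (simp add: gbinomial_prod_rev eval_nat_numeral lessThan_Suc algebra_simps)

text \<open>This is the case n = 2t, m = 2s, d = t+s+1. Upper negation of the two terms whose upper
  argument may be negative turns the expression into \<open>h x - h y\<close> with y \<le> x, so
  monotonicity of \<open>h\<close> suffices.\<close>

lemma mixed_difference_gbinomial_nonneg:
  fixes t s k :: nat
  assumes s: "1 \<le> s" and ts: "s \<le> t" and k: "k \<le> t + s + 1"
  defines "g \<equiv> \<lambda>a. (a - real (t + s + 1) + real k - 1) gchoose k"
  shows "0 \<le> g (real (2 * t + 2 * s)) - g (real (2 * t)) - g (real (2 * s)) + g 0"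
proof -
  define x where "x = t + s + 1"
  define y where "y = t - s + 1"
  define h :: "nat \<Rightarrow> real" where "h z = real ((z + k - 3) choose k) + (- 1) ^ k * real (z choose k)" for z
  \<comment> \<open>For k < 2 the function \<open>g\<close> is affine and its mixed difference
    vanishes. For larger \<open>k\<close> and positive \<open>z\<close> the natural number
    \<open>z + k - 3\<close> does not truncate.\<close>
  consider "k = 0" | "k = 1" | "2 \<le> k" by linarith
  then show ?thesis
  proof cases
    case 3
    have "real (2 * t + 2 * s) - real (t + s + 1) + real k - 1 = real (x + k - 3)"
      using 3 s ts by (simp add: x_def of_nat_diff)
    then have g1: "g (real (2 * t + 2 * s)) = real ((x + k - 3) choose k)"
      by (simp only: g_def binomial_gbinomial)
    have "real (2 * t) - real (t + s + 1) + real k - 1 = real (y + k - 3)"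
      using 3 ts by (simp add: y_def of_nat_diff)
    then have g2: "g (real (2 * t)) = real ((y + k - 3) choose k)"
      by (simp only: g_def binomial_gbinomial)
    have "real k - (real (2 * s) - real (t + s + 1) + real k - 1) - 1 = real y"
      using ts by (simp add: y_def of_nat_diff)
    then have g3: "g (real (2 * s)) = (- 1) ^ k * real (y choose k)"
      unfolding g_def by (subst gbinomial_negated_upper) (simp add: binomial_gbinomial)
    have "real k - (0 - real (t + s + 1) + real k - 1) - 1 = real x"
      by (simp add: x_def)
    then have g4: "g 0 = (- 1) ^ k * real (x choose k)"
      unfolding g_def by (subst gbinomial_negated_upper) (simp add: binomial_gbinomial)
    \<comment> \<open>For even \<open>k\<close> both summands increase. For odd \<open>k\<close>,
      Pascal's rule gives the increment C(z+k-3, k-1) - C(z, k-1), which is nonnegative because k is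
      at least 3.\<close>
    have step: "h z \<le> h (Suc z)" if "1 \<le> z" for z
    proof (cases "even k")
      case True
      have "(z + k - 3) choose k \<le> (Suc z + k - 3) choose k" "z choose k \<le> Suc z choose k"
        by (intro binomial_right_mono; simp)+
      then show ?thesis using True by (simp add: h_def)
    next
      case False
      then have "3 \<le> k" using 3 by (cases "k = 2") auto
      then obtain k' where k': "k = Suc k'" by (cases k) auto
      have "Suc z + k - 3 = Suc (z + k - 3)" using \<open>3 \<le> k\<close> by simp
      then have "(Suc z + k - 3) choose k = ((z + k - 3) choose k') + ((z + k - 3) choose k)"
        by (simp add: k')
      moreover have "Suc z choose k = (z choose k') + (z choose k)" by (simp add: k')
      moreover have "z choose k' \<le> (z + k - 3) choose k'"
        using \<open>3 \<le> k\<close> by (intro binomial_right_mono) simp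
      ultimately show ?thesis using False by (simp add: h_def)
    qed
    have "y \<le> x" by (simp add: x_def y_def)
    then have "h y \<le> h x"
    proof (induction x rule: dec_induct)
      case (step z)
      have "1 \<le> z" using step(1) by (simp add: y_def)
      then show ?case using step \<open>\<And>z. 1 \<le> z \<Longrightarrow> h z \<le> h (Suc z)\<close> by fastforce
    qed simp
    then show ?thesis using g1 g2 g3 g4 by (simp add: h_def)
  qed (simp_all add: g_def)
qed

text \<open>For k < 2 the mixed difference is 0 and for k = 2 it is n m, so k = 3 is the first index
  that restricts \<open>d\<close>.\<close>

lemma mixed_difference_gbinomial_3:
  fixes n m d :: "'a :: field_char_0"
  defines "g \<equiv> \<lambda>a. (a - d + 3 - 1) gchoose 3"
  shows "g (n + m) - g n - g m + g 0 = n * m * (n + m + 2 - 2 * d) / 2"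
  unfolding g_def gbinomial_3 by (simp add: field_simps)

section \<open>Monomial ideals and Stanley decompositions\<close>

lemma keys_add_nat: "Poly_Mapping.keys (a + b :: 'a \<Rightarrow>\<^sub>0 nat) = Poly_Mapping.keys a \<union> Poly_Mapping.keys b"
  by (auto simp: in_keys_iff lookup_add)

lemma single_eq_zero_iff: "Poly_Mapping.single a c = 0 \<longleftrightarrow> c = 0"
  by (simp flip: keys_eq_empty)

lemma sum_single_lookup_keys:
  "(\<Sum>a\<in>Poly_Mapping.keys f. Poly_Mapping.single a (Poly_Mapping.lookup f a)) = f"
proof (rule poly_mapping_eqI)
  fix b
  show "Poly_Mapping.lookup (\<Sum>a\<in>Poly_Mapping.keys f. Poly_Mapping.single a (Poly_Mapping.lookup f a)) b =
      Poly_Mapping.lookup f b"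
    by (cases "b \<in> Poly_Mapping.keys f") (auto simp: lookup_sum lookup_single when_def in_keys_iff)
qed

text \<open>Monomial ideals, the rings K[Z] and Stanley spaces generated by monomials are all of
  this form, so that direct sum decompositions turn into partitions of sets of exponents.\<close>

definition monomial_span :: "'a set \<Rightarrow> ('a \<Rightarrow>\<^sub>0 'b::zero) set" where
  "monomial_span E = {f. Poly_Mapping.keys f \<subseteq> E}"

lemma polys_in_eq_monomial_span: "polys_in Z = monomial_span {a. Poly_Mapping.keys a \<subseteq> Z}"
  by (auto simp: polys_in_def monomial_span_def)

lemma monomial_span_Int: "monomial_span A \<inter> monomial_span B = monomial_span (A \<inter> B)"
  by (auto simp: monomial_span_def)

lemma zero_in_monomial_span [simp]: "0 \<in> monomial_span E"
  by (simp add: monomial_span_def)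

lemma single_in_monomial_span_iff [simp]:
  "Poly_Mapping.single a c \<in> monomial_span E \<longleftrightarrow> a \<in> E \<or> c = 0"
  by (auto simp: monomial_span_def)

lemma sum_in_monomial_span:
  "(\<And>i. i \<in> I \<Longrightarrow> h i \<in> monomial_span E) \<Longrightarrow> sum h I \<in> monomial_span E"
  unfolding monomial_span_def using keys_sum[of h I] by fastforce

lemma mult_in_monomial_span:
  assumes "f \<in> monomial_span A" "g \<in> monomial_span B" "\<And>a b. a \<in> A \<Longrightarrow> b \<in> B \<Longrightarrow> a + b \<in> C"
  shows "f * g \<in> monomial_span C"
  using keys_mult[of f g] assms unfolding monomial_span_def by blast

lemma lookup_eq_0_of_monomial_span:
  "f \<in> monomial_span E \<Longrightarrow> a \<notin> E \<Longrightarrow> Poly_Mapping.lookup f a = 0"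
  by (auto simp: monomial_span_def in_keys_iff)

text \<open>By disjointness the coefficient of the sum at a point of \<open>E i\<close> is that of
  the component \<open>h i\<close>, which gives injectivity. A preimage of \<open>f\<close> is found
  by cutting its support along the sets \<open>E i\<close>.\<close>

lemma bij_betw_sum_monomial_span:
  fixes E :: "nat \<Rightarrow> 'a set"
  assumes disj: "disjoint_family_on E {..<l}" and G: "(\<Union>i<l. E i) = G"
  shows "bij_betw (\<lambda>h. \<Sum>i<l. h i) (\<Pi>\<^sub>E i\<in>{..<l}. monomial_span (E i))
    (monomial_span G :: ('a \<Rightarrow>\<^sub>0 'b::comm_monoid_add) set)"
proof -
  let ?P = "\<Pi>\<^sub>E i\<in>{..<l}. monomial_span (E i) :: ('a \<Rightarrow>\<^sub>0 'b) set"
  have lookup: "Poly_Mapping.lookup (\<Sum>i<l. h i) a = Poly_Mapping.lookup (h i) a"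
    if h: "h \<in> ?P" and i: "i < l" "a \<in> E i" for h i a
  proof -
    have "Poly_Mapping.lookup (h j) a = 0" if "j < l" "j \<noteq> i" for j
    proof (rule lookup_eq_0_of_monomial_span)
      show "h j \<in> monomial_span (E j)" using h that by auto
      show "a \<notin> E j" using disj that i by (auto simp: disjoint_family_on_def)
    qed
    then have "(\<Sum>j<l. Poly_Mapping.lookup (h j) a) = (\<Sum>j\<in>{i}. Poly_Mapping.lookup (h j) a)"
      using i by (intro sum.mono_neutral_right) auto
    then show ?thesis by (simp add: lookup_sum)
  qed
  show ?thesis
    unfolding bij_betw_def
  proof
    show "inj_on (\<lambda>h. \<Sum>i<l. h i) ?P"
    proof (rule inj_onI)
      fix h h' assume *: "h \<in> ?P" "h' \<in> ?P" "(\<Sum>i<l. h i) = (\<Sum>i<l. h' i)"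
      show "h = h'"
      proof (rule PiE_ext[OF *(1,2)])
        fix i assume i: "i \<in> {..<l}"
        show "h i = h' i"
        proof (rule poly_mapping_eqI)
          fix a
          show "Poly_Mapping.lookup (h i) a = Poly_Mapping.lookup (h' i) a"
          proof (cases "a \<in> E i")
            case True
            then show ?thesis using lookup[OF *(1), of i a] lookup[OF *(2), of i a] *(3) i by simp
          next
            case False
            have "h i \<in> monomial_span (E i)" "h' i \<in> monomial_span (E i)" using * i by auto
            then show ?thesis using False by (simp add: lookup_eq_0_of_monomial_span)
          qed
        qed
      qed
    qed
    show "(\<lambda>h. \<Sum>i<l. h i) ` ?P = monomial_span G"
    proof
      have "E i \<subseteq> G" if "i < l" for i using G that by blast
      then have "monomial_span (E i) \<subseteq> (monomial_span G :: ('a \<Rightarrow>\<^sub>0 'b) set)" if "i < l" for i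
        using that unfolding monomial_span_def by blast
      then show "(\<lambda>h. \<Sum>i<l. h i) ` ?P \<subseteq> monomial_span G"
        by (intro image_subsetI sum_in_monomial_span) auto
      show "monomial_span G \<subseteq> (\<lambda>h. \<Sum>i<l. h i) ` ?P"
      proof
        fix f :: "'a \<Rightarrow>\<^sub>0 'b" assume f: "f \<in> monomial_span G"
        define h where "h = (\<lambda>i\<in>{..<l}. \<Sum>a\<in>Poly_Mapping.keys f \<inter> E i.
          Poly_Mapping.single a (Poly_Mapping.lookup f a))"
        have h: "h \<in> ?P" unfolding h_def by (auto intro!: sum_in_monomial_span)
        have "(\<Sum>i<l. h i) = f"
        proof (rule poly_mapping_eqI)
          fix a
          show "Poly_Mapping.lookup (\<Sum>i<l. h i) a = Poly_Mapping.lookup f a"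
          proof (cases "a \<in> G")
            case True
            then obtain i where i: "i < l" "a \<in> E i" using G by auto
            then have "Poly_Mapping.lookup (h i) a = Poly_Mapping.lookup f a"
              by (cases "a \<in> Poly_Mapping.keys f")
                (auto simp: h_def lookup_sum lookup_single when_def in_keys_iff)
            then show ?thesis using lookup[OF h i] by simp
          next
            case False
            have "(\<Sum>i<l. h i) \<in> monomial_span G"
              using h \<open>(\<lambda>h. \<Sum>i<l. h i) ` ?P \<subseteq> monomial_span G\<close> by blast
            then show ?thesis using False f by (simp add: lookup_eq_0_of_monomial_span)
          qed
        qed
        then show "f \<in> (\<lambda>h. \<Sum>i<l. h i) ` ?P" using h by blast
      qed
    qed
  qed
qed

text \<open>The converse is tested on single monomials: one lying in both \<open>E i\<close> and
  \<open>E j\<close> could be put into either slot with the same sum, and one lying in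
  \<open>G\<close> must receive its coefficient from some slot.\<close>

lemma bij_betw_sum_monomial_spanD:
  fixes E :: "nat \<Rightarrow> 'a set"
  assumes bij: "bij_betw (\<lambda>h. \<Sum>i<l. h i) (\<Pi>\<^sub>E i\<in>{..<l}. monomial_span (E i))
    (monomial_span G :: ('a \<Rightarrow>\<^sub>0 'b::{comm_monoid_add, zero_neq_one}) set)"
  shows "disjoint_family_on E {..<l}" "(\<Union>i<l. E i) = G"
proof -
  let ?P = "\<Pi>\<^sub>E i\<in>{..<l}. monomial_span (E i) :: ('a \<Rightarrow>\<^sub>0 'b) set"
  define h :: "nat \<Rightarrow> 'a \<Rightarrow> nat \<Rightarrow> 'a \<Rightarrow>\<^sub>0 'b"
    where "h i a = (\<lambda>j\<in>{..<l}. if j = i then Poly_Mapping.single a 1 else 0)" for i a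
  have h: "h i a \<in> ?P" "(\<Sum>j<l. h i a j) = Poly_Mapping.single a 1" if "i < l" "a \<in> E i" for i a
    using that by (auto simp: h_def)
  show "disjoint_family_on E {..<l}"
    unfolding disjoint_family_on_def
  proof (intro ballI impI)
    fix i j assume ij: "i \<in> {..<l}" "j \<in> {..<l}" "i \<noteq> j"
    show "E i \<inter> E j = {}"
    proof (rule ccontr)
      assume "E i \<inter> E j \<noteq> {}"
      then obtain a where a: "a \<in> E i" "a \<in> E j" by auto
      have l: "i < l" "j < l" using ij by simp_all
      have "(\<Sum>k<l. h i a k) = (\<Sum>k<l. h j a k)" by (simp only: h(2)[OF l(1) a(1)] h(2)[OF l(2) a(2)])
      then have "h i a = h j a"
        by (rule inj_onD[OF bij_betw_imp_inj_on[OF bij] _ h(1)[OF l(1) a(1)] h(1)[OF l(2) a(2)]])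
      then have "h i a i = h j a i" by simp
      then have "Poly_Mapping.single a (1 :: 'b) = 0" using ij by (simp add: h_def)
      then have "Poly_Mapping.lookup (Poly_Mapping.single a (1 :: 'b)) a = 0" by simp
      then show False by simp
    qed
  qed
  show "(\<Union>i<l. E i) = G"
  proof
    have "Poly_Mapping.single a (1 :: 'b) \<in> monomial_span G" if "i < l" "a \<in> E i" for i a
      using bij_betwE[OF bij] h[OF that] by metis
    then show "(\<Union>i<l. E i) \<subseteq> G" by auto
    show "G \<subseteq> (\<Union>i<l. E i)"
    proof
      fix a assume "a \<in> G"
      then have "Poly_Mapping.single a (1 :: 'b) \<in> (\<lambda>h. \<Sum>i<l. h i) ` ?P"
        using bij_betw_imp_surj_on[OF bij] by simp
      then obtain g where g: "g \<in> ?P" "(\<Sum>i<l. g i) = Poly_Mapping.single a (1 :: 'b)" by auto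
      have "(\<Sum>i<l. Poly_Mapping.lookup (g i) a) = 1"
        using arg_cong[OF g(2), of "\<lambda>f. Poly_Mapping.lookup f a"] by (simp add: lookup_sum)
      then obtain i where i: "i < l" "Poly_Mapping.lookup (g i) a \<noteq> 0"
        by (metis lessThan_iff sum.neutral zero_neq_one)
      then have "g i \<in> monomial_span (E i)" using g(1) by auto
      then have "a \<in> E i" using i(2) lookup_eq_0_of_monomial_span by metis
      then show "a \<in> (\<Union>i<l. E i)" using i(1) by blast
    qed
  qed
qed

section \<open>Stanley spaces as cones of exponents\<close>

definition exponent_cone :: "(nat \<Rightarrow>\<^sub>0 nat) \<Rightarrow> nat set \<Rightarrow> (nat \<Rightarrow>\<^sub>0 nat) set" where
  "exponent_cone b Z = {a + b |a. Poly_Mapping.keys a \<subseteq> Z}"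

lemma stanley_space_single:
  assumes "c \<noteq> (0 :: 'k::field)"
  shows "stanley_space (Poly_Mapping.single b c) Z = monomial_span (exponent_cone b Z)"
proof
  show "stanley_space (Poly_Mapping.single b c) Z \<subseteq> monomial_span (exponent_cone b Z)"
  proof
    fix f assume "f \<in> stanley_space (Poly_Mapping.single b c) Z"
    then obtain u where u: "u \<in> polys_in Z" "f = u * Poly_Mapping.single b c"
      by (auto simp: stanley_space_def)
    show "f \<in> monomial_span (exponent_cone b Z)"
      using keys_mult[of u "Poly_Mapping.single b c"] u assms
      by (fastforce simp: monomial_span_def exponent_cone_def polys_in_def)
  qed
  show "monomial_span (exponent_cone b Z) \<subseteq> stanley_space (Poly_Mapping.single b c) Z"
  proof
    fix f :: "'k mpoly" assume f: "f \<in> monomial_span (exponent_cone b Z)"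
    \<comment> \<open>The quotient of \<open>f\<close> by the monomial. Every exponent of
      \<open>f\<close> lies in the cone, so the subtraction \<open>a - b\<close> is exact.\<close>
    define u where "u = (\<Sum>a\<in>Poly_Mapping.keys f.
      Poly_Mapping.single (a - b) (Poly_Mapping.lookup f a / c))"
    have cone: "\<exists>a'. a = a' + b \<and> Poly_Mapping.keys a' \<subseteq> Z" if "a \<in> Poly_Mapping.keys f" for a
      using f that by (auto simp: monomial_span_def exponent_cone_def)
    have "u \<in> polys_in Z"
      unfolding polys_in_eq_monomial_span u_def
      by (rule sum_in_monomial_span) (use cone in fastforce)
    moreover have "f = u * Poly_Mapping.single b c"
    proof -
      have "u * Poly_Mapping.single b c =
          (\<Sum>a\<in>Poly_Mapping.keys f. Poly_Mapping.single a (Poly_Mapping.lookup f a))"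
        unfolding u_def sum_distrib_right
      proof (rule sum.cong)
        fix a assume "a \<in> Poly_Mapping.keys f"
        from cone[OF this] show "Poly_Mapping.single (a - b) (Poly_Mapping.lookup f a / c) *
            Poly_Mapping.single b c = Poly_Mapping.single a (Poly_Mapping.lookup f a)"
          using assms by (auto simp: mult_single)
      qed simp
      then show ?thesis by (simp add: sum_single_lookup_keys)
    qed
    ultimately show "f \<in> stanley_space (Poly_Mapping.single b c) Z"
      by (auto simp: stanley_space_def)
  qed
qed

lemma homogeneous_nonzeroE:
  assumes "homogeneous g" "g \<noteq> 0"
  obtains b c where "c \<noteq> 0" "g = Poly_Mapping.single b c"
proof -
  obtain b where "Poly_Mapping.keys g \<subseteq> {b}" using assms by (auto simp: homogeneous_def)
  then have "Poly_Mapping.keys g = {b}" using assms(2) by (auto simp: subset_singleton_iff)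
  then show thesis
    using that[of "Poly_Mapping.lookup g b" b] sum_single_lookup_keys[of g]
    by (auto simp: in_keys_iff[symmetric])
qed

text \<open>Homogeneous nonzero generators are scalar multiples of monomials, so a decomposition of
  a span is a partition of its exponents into cones.\<close>

lemma stanley_decompositionE:
  fixes D :: "('k::field mpoly \<times> nat set) list"
  assumes "stanley_decomposition p (monomial_span G) D"
  obtains b where "disjoint_family_on (\<lambda>i. exponent_cone (b i) (snd (D ! i))) {..<length D}"
    "(\<Union>i<length D. exponent_cone (b i) (snd (D ! i))) = G"
    "\<And>i. i < length D \<Longrightarrow> snd (D ! i) \<subseteq> {1..p}"
proof -
  have D: "homogeneous (fst (D ! i))" "fst (D ! i) \<noteq> 0" "snd (D ! i) \<subseteq> {1..p}" if "i < length D" for i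
  proof -
    have "D ! i \<in> set D" using that by simp
    with assms have *: "homogeneous (fst (D ! i))" "snd (D ! i) \<subseteq> {1..p}"
      "\<forall>u\<in>polys_in (snd (D ! i)). u * fst (D ! i) = 0 \<longrightarrow> u = 0"
      unfolding stanley_decomposition_def by (auto simp: split_beta)
    \<comment> \<open>Freeness tested at u = 1 shows that the generator is nonzero.\<close>
    moreover have "(1 :: 'k mpoly) \<in> polys_in (snd (D ! i))" by (simp add: polys_in_def)
    ultimately show "homogeneous (fst (D ! i))" "fst (D ! i) \<noteq> 0" "snd (D ! i) \<subseteq> {1..p}" by force+
  qed
  have "\<exists>b c. c \<noteq> 0 \<and> fst (D ! i) = Poly_Mapping.single b c" if "i < length D" for i
    using homogeneous_nonzeroE[OF D(1,2)[OF that]] by metis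
  then obtain b c where bc: "\<And>i. i < length D \<Longrightarrow> c i \<noteq> 0 \<and> fst (D ! i) = Poly_Mapping.single (b i) (c i)"
    by metis
  have "bij_betw (\<lambda>h. \<Sum>i<length D. h i)
      (\<Pi>\<^sub>E i\<in>{..<length D}. stanley_space (fst (D ! i)) (snd (D ! i))) (monomial_span G)"
    using assms by (simp add: stanley_decomposition_def)
  also have "(\<Pi>\<^sub>E i\<in>{..<length D}. stanley_space (fst (D ! i)) (snd (D ! i))) =
      (\<Pi>\<^sub>E i\<in>{..<length D}. monomial_span (exponent_cone (b i) (snd (D ! i))))"
    by (intro PiE_cong) (simp add: bc stanley_space_single)
  finally have bij: "bij_betw (\<lambda>h. \<Sum>i<length D. h i)
      (\<Pi>\<^sub>E i\<in>{..<length D}. monomial_span (exponent_cone (b i) (snd (D ! i))))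
      (monomial_span G :: 'k mpoly set)" .
  show thesis
    by (rule that[OF bij_betw_sum_monomial_spanD[OF bij] D(3)])
qed

lemma stanley_decompositionI:
  fixes D :: "('k::field mpoly \<times> nat set) list"
  assumes D: "\<And>i. i < length D \<Longrightarrow> fst (D ! i) = Poly_Mapping.single (b i) 1 \<and> snd (D ! i) \<subseteq> {1..p}"
    and disj: "disjoint_family_on (\<lambda>i. exponent_cone (b i) (snd (D ! i))) {..<length D}"
    and un: "(\<Union>i<length D. exponent_cone (b i) (snd (D ! i))) = G"
  shows "stanley_decomposition p (monomial_span G) D"
  unfolding stanley_decomposition_def
proof
  show "\<forall>(g, Z)\<in>set D. g \<in> monomial_span G \<and> homogeneous g \<and>
      (\<forall>u\<in>polys_in Z. u * g = 0 \<longrightarrow> u = 0) \<and> Z \<subseteq> {1..p}"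
  proof
    fix gZ assume "gZ \<in> set D"
    then obtain i where i: "i < length D" "gZ = D ! i" by (auto simp: in_set_conv_nth)
    have "b i \<in> exponent_cone (b i) (snd (D ! i))"
      unfolding exponent_cone_def by (auto intro: exI[of _ 0])
    then have "b i \<in> G" using un i by blast
    then show "case gZ of (g, Z) \<Rightarrow> g \<in> monomial_span G \<and> homogeneous g \<and>
      (\<forall>u\<in>polys_in Z. u * g = 0 \<longrightarrow> u = 0) \<and> Z \<subseteq> {1..p}"
      using D[OF i(1)] i(2) by (cases gZ) (auto simp: homogeneous_def single_eq_zero_iff)
  qed
  have "(\<Pi>\<^sub>E i\<in>{..<length D}. stanley_space (fst (D ! i)) (snd (D ! i))) =
      (\<Pi>\<^sub>E i\<in>{..<length D}. monomial_span (exponent_cone (b i) (snd (D ! i))))"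
    by (intro PiE_cong) (simp add: D stanley_space_single)
  then show "bij_betw (\<lambda>h. \<Sum>i<length D. h i)
      (\<Pi>\<^sub>E i\<in>{..<length D}. stanley_space (fst (D ! i)) (snd (D ! i))) (monomial_span G)"
    using bij_betw_sum_monomial_span[OF disj un] by simp
qed

section \<open>Ideals generated by variables\<close>

lemma poly_ring_simps:
  "carrier (poly_ring p) = polys_in {1..p}" "f \<otimes>\<^bsub>poly_ring p\<^esub> g = f * g"
  "f \<oplus>\<^bsub>poly_ring p\<^esub> g = f + g" "\<zero>\<^bsub>poly_ring p\<^esub> = 0" "\<one>\<^bsub>poly_ring p\<^esub> = 1"
  by (simp_all add: poly_ring_def)

lemma ring_poly_ring: "ring (poly_ring p :: 'k::field mpoly ring)"
proof -
  have closed: "f + g \<in> polys_in Z" "f * g \<in> polys_in Z" "- f \<in> polys_in Z"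
    if "f \<in> polys_in Z" "g \<in> polys_in Z" for f g :: "'k mpoly" and Z
    using that Poly_Mapping.keys_add[of f g] keys_mult[of f g]
    by (fastforce simp: polys_in_def keys_add_nat)+
  show ?thesis
  proof (rule ringI)
    show "abelian_group (poly_ring p :: 'k mpoly ring)"
    proof (rule abelian_groupI)
      fix x assume "x \<in> carrier (poly_ring p :: 'k mpoly ring)"
      then show "\<exists>y\<in>carrier (poly_ring p). y \<oplus>\<^bsub>poly_ring p\<^esub> x = \<zero>\<^bsub>poly_ring p\<^esub>"
        by (intro bexI[of _ "- x"]) (auto simp: poly_ring_simps closed)
    qed (auto simp: poly_ring_simps closed algebra_simps, simp add: polys_in_def)
    show "monoid (poly_ring p :: 'k mpoly ring)"
      by (rule monoidI) (auto simp: poly_ring_simps closed algebra_simps, simp add: polys_in_def)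
  qed (auto simp: poly_ring_simps algebra_simps)
qed

text \<open>The span is an ideal containing the variables, which gives one inclusion. Conversely,
  each term of a member of the span is a multiple of some variable indexed by
  \<open>A\<close>.\<close>

lemma genideal_Var:
  assumes A: "A \<subseteq> {1..p}"
  shows "Idl\<^bsub>poly_ring p\<^esub> (Var ` A) =
    (monomial_span {a. Poly_Mapping.keys a \<subseteq> {1..p} \<and> Poly_Mapping.keys a \<inter> A \<noteq> {}} :: 'k::field mpoly set)"
    (is "_ = ?M")
proof
  interpret ring "poly_ring p :: 'k mpoly ring" by (rule ring_poly_ring)
  have VarA: "Var ` A \<subseteq> ?M" using A by (auto simp: Var_def)
  have "ideal ?M (poly_ring p)"
  proof (rule idealI[OF ring_poly_ring])
    show "subgroup ?M (add_monoid (poly_ring p))"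
    proof (rule add.subgroupI)
      show "?M \<noteq> {}" using zero_in_monomial_span by blast
      show "?M \<subseteq> carrier (poly_ring p)" by (auto simp: poly_ring_simps polys_in_def monomial_span_def)
    next
      fix a b :: "'k mpoly" assume ab: "a \<in> ?M" "b \<in> ?M"
      then show "a \<oplus>\<^bsub>poly_ring p\<^esub> b \<in> ?M"
        using Poly_Mapping.keys_add[of a b] by (auto simp: poly_ring_simps monomial_span_def)
    next
      fix a :: "'k mpoly" assume a: "a \<in> ?M"
      then have "- a \<in> carrier (poly_ring p)" "a \<in> carrier (poly_ring p)"
        by (auto simp: poly_ring_simps polys_in_def monomial_span_def)
      moreover have "a \<oplus>\<^bsub>poly_ring p\<^esub> - a = \<zero>\<^bsub>poly_ring p\<^esub>" by (simp add: poly_ring_simps)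
      ultimately have "\<ominus>\<^bsub>poly_ring p\<^esub> a = - a" by (metis minus_equality r_neg minus_minus add.m_comm)
      then show "\<ominus>\<^bsub>poly_ring p\<^esub> a \<in> ?M" using a by (auto simp: monomial_span_def)
    qed
  next
    fix a x :: "'k mpoly" assume ax: "a \<in> ?M" "x \<in> carrier (poly_ring p)"
    then show "x \<otimes>\<^bsub>poly_ring p\<^esub> a \<in> ?M"
      unfolding poly_ring_simps polys_in_eq_monomial_span
      by (simp, elim mult_in_monomial_span) (auto simp: keys_add_nat)
    then show "a \<otimes>\<^bsub>poly_ring p\<^esub> x \<in> ?M" by (simp add: poly_ring_simps mult.commute)
  qed
  then show "Idl\<^bsub>poly_ring p\<^esub> (Var ` A) \<subseteq> ?M" using VarA by (rule genideal_minimal)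
  have Vc: "Var ` A \<subseteq> carrier (poly_ring p :: 'k mpoly ring)"
    using A by (auto simp: poly_ring_simps polys_in_def Var_def)
  interpret J: ideal "Idl\<^bsub>poly_ring p\<^esub> (Var ` A)" "poly_ring p :: 'k mpoly ring"
    by (rule genideal_ideal[OF Vc])
  let ?J = "Idl\<^bsub>poly_ring p\<^esub> (Var ` A) :: 'k mpoly set"
  show "?M \<subseteq> ?J"
  proof
    fix f :: "'k mpoly" assume f: "f \<in> ?M"
    have summand: "Poly_Mapping.single a (Poly_Mapping.lookup f a) \<in> ?J" if a: "a \<in> Poly_Mapping.keys f" for a
    proof -
      obtain i where i: "i \<in> A" "i \<in> Poly_Mapping.keys a" and ka: "Poly_Mapping.keys a \<subseteq> {1..p}"
        using f a unfolding monomial_span_def by blast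
      define a' where "a' = a - Poly_Mapping.single i 1"
      have aeq: "a = a' + Poly_Mapping.single i 1"
        using i(2) by (intro poly_mapping_eqI)
          (auto simp: a'_def lookup_add lookup_minus lookup_single when_def in_keys_iff)
      have "Poly_Mapping.keys a' \<subseteq> {1..p}"
        using ka by (simp add: aeq keys_add_nat)
      then have "Poly_Mapping.single a' (Poly_Mapping.lookup f a) \<in> carrier (poly_ring p)"
        by (simp add: poly_ring_simps polys_in_def)
      moreover have "Var i \<in> ?J" using genideal_self[OF Vc] i(1) by blast
      ultimately have "Poly_Mapping.single a' (Poly_Mapping.lookup f a) * Var i \<in> ?J"
        using J.I_l_closed[of "Var i"] by (simp add: poly_ring_simps)
      also have "Poly_Mapping.single a' (Poly_Mapping.lookup f a) * Var i =
          Poly_Mapping.single a (Poly_Mapping.lookup f a)"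
        unfolding aeq Var_def mult_single by simp
      finally show ?thesis .
    qed
    have "(\<Sum>a\<in>K. Poly_Mapping.single a (Poly_Mapping.lookup f a)) \<in> ?J"
      if "finite K" "K \<subseteq> Poly_Mapping.keys f" for K
      using that
    proof (induction K)
      case empty
      then show ?case using additive_subgroup.zero_closed[OF J.is_additive_subgroup] by (simp add: poly_ring_simps)
    next
      case (insert a K)
      then show ?case
        using additive_subgroup.a_closed[OF J.is_additive_subgroup
            summand[of a], of "\<Sum>a\<in>K. Poly_Mapping.single a (Poly_Mapping.lookup f a)"]
        by (simp add: poly_ring_simps)
    qed
    from this[of "Poly_Mapping.keys f"] show "f \<in> ?J" by (simp add: sum_single_lookup_keys)
  qed
qed

section \<open>The squarefree part\<close>

text \<open>The exponent of the squarefree monomial with support \<open>F\<close>. For infinite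
  \<open>F\<close> the sum defaults to 0, hence the finiteness assumptions below.\<close>

definition indicator_exp :: "'a set \<Rightarrow> 'a \<Rightarrow>\<^sub>0 nat" where
  "indicator_exp F = (\<Sum>i\<in>F. Poly_Mapping.single i 1)"

lemma lookup_indicator_exp:
  "finite F \<Longrightarrow> Poly_Mapping.lookup (indicator_exp F) i = (if i \<in> F then 1 else 0)"
  by (simp add: indicator_exp_def lookup_sum lookup_single when_def)

lemma keys_indicator_exp [simp]: "finite F \<Longrightarrow> Poly_Mapping.keys (indicator_exp F) = F"
  by (auto simp: in_keys_iff lookup_indicator_exp split: if_splits)

lemma prod_Var: "(\<Prod>i\<in>F. Var i :: 'k::field mpoly) = Poly_Mapping.single (indicator_exp F) 1"
  by (induction F rule: infinite_finite_induct)
    (simp_all add: indicator_exp_def Var_def mult_single)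

text \<open>A squarefree monomial is determined by its support and is never 0, so subtracting the
  zero ideal removes nothing from the count.\<close>

lemma hd_alpha_monomial_span:
  "hd_alpha p (monomial_span G :: 'k::field mpoly set) {0} j =
    card {F. F \<subseteq> {1..p} \<and> card F = j \<and> indicator_exp F \<in> G}"
proof -
  let ?e = "\<lambda>F. Poly_Mapping.single (indicator_exp F) 1 :: 'k mpoly"
  have "inj_on ?e {F. F \<subseteq> {1..p}}"
  proof (rule inj_onI)
    fix F F' assume *: "F \<in> {F. F \<subseteq> {1..p}}" "F' \<in> {F. F \<subseteq> {1..p}}" "?e F = ?e F'"
    have "{indicator_exp F} = {indicator_exp F'}"
      using arg_cong[OF *(3), of Poly_Mapping.keys] by simp
    then have "Poly_Mapping.keys (indicator_exp F) = Poly_Mapping.keys (indicator_exp F')" by simp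
    then show "F = F'" using * finite_subset[of _ "{1..p}"] by simp
  qed
  then have "inj_on ?e {F. F \<subseteq> {1..p} \<and> card F = j \<and> indicator_exp F \<in> G}"
    by (rule inj_on_subset) auto
  moreover have "squarefree_monomials p j \<inter> (monomial_span G - {0}) =
      ?e ` {F. F \<subseteq> {1..p} \<and> card F = j \<and> indicator_exp F \<in> G}"
    unfolding squarefree_monomials_def prod_Var by (auto simp: single_eq_zero_iff)
  ultimately show ?thesis unfolding hd_alpha_def by (simp add: card_image)
qed

text \<open>If the cone contains a squarefree exponent, then \<open>b\<close> is squarefree as well.
  With \<open>X\<close> its support, the squarefree members have supports between \<open>X\<close>
  and \<open>X \<union> Z\<close>. Through \<open>Z \<subseteq> Y\<close> a lower bound on the size
  of \<open>Z\<close> passes to \<open>Y\<close>.\<close>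

lemma squarefree_part_exponent_cone:
  assumes Z: "Z \<subseteq> {1..p}"
  obtains "{F. F \<subseteq> {1..p} \<and> indicator_exp F \<in> exponent_cone b Z} = {}"
  | X Y where "{F. F \<subseteq> {1..p} \<and> indicator_exp F \<in> exponent_cone b Z} = {X..Y}"
    "X \<subseteq> Y" "Z \<subseteq> Y" "Y \<subseteq> {1..p}"
proof (cases "{F. F \<subseteq> {1..p} \<and> indicator_exp F \<in> exponent_cone b Z} = {}")
  case False
  have fin: "finite F" if "F \<subseteq> {1..p}" for F using that finite_subset by blast
  obtain F a where F: "F \<subseteq> {1..p}" "indicator_exp F = a + b" "Poly_Mapping.keys a \<subseteq> Z"
    using False by (auto simp: exponent_cone_def)
  define X where "X = Poly_Mapping.keys b"
  have "Poly_Mapping.keys (indicator_exp F) = Poly_Mapping.keys a \<union> X"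
    unfolding F(2) by (simp add: keys_add_nat X_def)
  then have XF: "X \<subseteq> F" using fin[OF F(1)] by auto
  have finX: "finite X" by (simp add: X_def)
  have b: "b = indicator_exp X"
  proof (rule poly_mapping_eqI)
    fix i
    \<comment> \<open>As a summand of an indicator vector, \<open>b\<close> has entries 0 and 1
      only.\<close>
    have "Poly_Mapping.lookup a i + Poly_Mapping.lookup b i \<le> 1"
      using arg_cong[OF F(2), of "\<lambda>f. Poly_Mapping.lookup f i"] fin[OF F(1)]
      by (simp add: lookup_add lookup_indicator_exp split: if_splits)
    then show "Poly_Mapping.lookup b i = Poly_Mapping.lookup (indicator_exp X) i"
      by (auto simp: lookup_indicator_exp X_def in_keys_iff)
  qed
  have "F' \<subseteq> {1..p} \<and> indicator_exp F' \<in> exponent_cone b Z \<longleftrightarrow> F' \<in> {X..X \<union> Z}" for F'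
  proof
    assume F': "F' \<subseteq> {1..p} \<and> indicator_exp F' \<in> exponent_cone b Z"
    then obtain a' where a': "indicator_exp F' = a' + b" "Poly_Mapping.keys a' \<subseteq> Z"
      by (auto simp: exponent_cone_def)
    have "Poly_Mapping.keys (indicator_exp F') = Poly_Mapping.keys a' \<union> X"
      unfolding a'(1) by (simp add: keys_add_nat X_def)
    then show "F' \<in> {X..X \<union> Z}" using fin F' a'(2) by auto
  next
    assume F': "F' \<in> {X..X \<union> Z}"
    then have "F' \<subseteq> X \<union> Z" by simp
    then have sub: "F' \<subseteq> {1..p}" using XF F(1) Z by blast
    have "indicator_exp F' = indicator_exp (F' - X) + b"
      using F' fin[OF sub] finX
      by (intro poly_mapping_eqI) (auto simp: b lookup_add lookup_indicator_exp)
    moreover have "Poly_Mapping.keys (indicator_exp (F' - X)) \<subseteq> Z"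
      using F' fin[OF sub] by auto
    ultimately show "F' \<subseteq> {1..p} \<and> indicator_exp F' \<in> exponent_cone b Z"
      using sub unfolding exponent_cone_def by blast
  qed
  then show ?thesis using XF F(1) Z by (intro that(2)[of X "X \<union> Z"]) auto
qed

section \<open>From Stanley decompositions to the Hilbert depth\<close>

lemma card_interval_of_card:
  assumes "finite Y" "X \<subseteq> Y"
  shows "card {F \<in> {X..Y}. card F = j} =
    (if card X \<le> j then (card Y - card X) choose (j - card X) else 0)"
proof (cases "card X \<le> j")
  case True
  have fin: "finite X" using assms finite_subset by blast
  have "bij_betw (\<lambda>F. F \<union> X) {F. F \<subseteq> Y - X \<and> card F = j - card X} {F \<in> {X..Y}. card F = j}"
  proof (rule bij_betw_byWitness[where f' = "\<lambda>F. F - X"])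
    have "card (F \<union> X) = j" if "F \<subseteq> Y - X" "card F = j - card X" for F
    proof -
      have "finite F" using that(1) assms(1) finite_subset by blast
      then show ?thesis using that fin True by (subst card_Un_disjoint) auto
    qed
    then show "(\<lambda>F. F \<union> X) ` {F. F \<subseteq> Y - X \<and> card F = j - card X} \<subseteq> {F \<in> {X..Y}. card F = j}"
      using assms by auto
    show "(\<lambda>F. F - X) ` {F \<in> {X..Y}. card F = j} \<subseteq> {F. F \<subseteq> Y - X \<and> card F = j - card X}"
      using fin by (auto simp: card_Diff_subset)
  qed auto
  then have "card {F \<in> {X..Y}. card F = j} = card {F. F \<subseteq> Y - X \<and> card F = j - card X}"
    by (simp add: bij_betw_same_card)
  also have "\<dots> = card (Y - X) choose (j - card X)" using assms by (intro n_subsets) simp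
  finally show ?thesis using True assms fin by (simp add: card_Diff_subset)
next
  case False
  have "{F \<in> {X..Y}. card F = j} = {}"
    using False card_mono[OF finite_subset[OF _ assms(1)]] by fastforce
  then show ?thesis using False by (simp only: card.empty if_False)
qed

text \<open>The number \<open>hd_beta\<close> is linear in the counts \<open>hd_alpha\<close>, which
  add up over the disjoint cones. A cone contributes 0 or the nonnegative sum of an interval whose
  upper end has at least \<open>sdepth_decomp D\<close> elements.\<close>

lemma sdepth_decomp_admissible:
  fixes D :: "('k::field mpoly \<times> nat set) list"
  assumes D: "stanley_decomposition p (monomial_span G) D" and G: "G \<noteq> {}"
  shows "sdepth_decomp D \<le> p" "k \<le> sdepth_decomp D \<Longrightarrow> 0 \<le> hd_beta p (monomial_span G :: 'k mpoly set) {0} (sdepth_decomp D) k"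
proof -
  obtain b where disj: "disjoint_family_on (\<lambda>i. exponent_cone (b i) (snd (D ! i))) {..<length D}"
    and un: "(\<Union>i<length D. exponent_cone (b i) (snd (D ! i))) = G"
    and sub: "\<And>i. i < length D \<Longrightarrow> snd (D ! i) \<subseteq> {1..p}"
    by (rule stanley_decompositionE[OF D]) blast
  let ?d = "sdepth_decomp D"
  have le: "?d \<le> card (snd (D ! i))" if "i < length D" for i
    unfolding sdepth_decomp_def using nth_mem[OF that]
    by (intro Min_le) (auto intro!: image_eqI[of _ _ "D ! i"] simp: split_beta)
  \<comment> \<open>A nonempty \<open>G\<close> provides a first cone, whose variable set bounds the
    depth by \<open>p\<close>.\<close>
  have "length D > 0" using un G by auto
  then show "?d \<le> p" using le[of 0] card_mono[OF _ sub[of 0]] by simp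
  define C where "C i j = card {F. F \<subseteq> {1..p} \<and> card F = j \<and> indicator_exp F \<in> exponent_cone (b i) (snd (D ! i))}" for i j
  have alpha: "hd_alpha p (monomial_span G :: 'k mpoly set) {0} j = (\<Sum>i<length D. C i j)" for j
  proof -
    have "{F. F \<subseteq> {1..p} \<and> card F = j \<and> indicator_exp F \<in> G} =
        (\<Union>i<length D. {F. F \<subseteq> {1..p} \<and> card F = j \<and> indicator_exp F \<in> exponent_cone (b i) (snd (D ! i))})"
      unfolding un[symmetric] by auto
    moreover have "card \<dots> = (\<Sum>i<length D. C i j)"
      unfolding C_def
    proof (rule card_UN_disjoint)
      have "finite {F. F \<subseteq> {1..p}}" by simp
      then show "\<forall>i\<in>{..<length D}. finite {F. F \<subseteq> {1..p} \<and> card F = j \<and>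
          indicator_exp F \<in> exponent_cone (b i) (snd (D ! i))}"
        by (auto elim: finite_subset[rotated])
      show "\<forall>i\<in>{..<length D}. \<forall>i'\<in>{..<length D}. i \<noteq> i' \<longrightarrow>
          {F. F \<subseteq> {1..p} \<and> card F = j \<and> indicator_exp F \<in> exponent_cone (b i) (snd (D ! i))} \<inter>
          {F. F \<subseteq> {1..p} \<and> card F = j \<and> indicator_exp F \<in> exponent_cone (b i') (snd (D ! i'))} = {}"
        using disj unfolding disjoint_family_on_def by blast
    qed simp
    ultimately show ?thesis by (simp add: hd_alpha_monomial_span)
  qed
  show "0 \<le> hd_beta p (monomial_span G :: 'k mpoly set) {0} ?d k" if k: "k \<le> ?d"
  proof -
    have "0 \<le> (\<Sum>j=0..k. (- 1) ^ (k - j) * int ((?d - j) choose (k - j)) * int (C i j))"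
      if i: "i < length D" for i
    proof (rule squarefree_part_exponent_cone[OF sub[OF i], of "b i"])
      assume "{F. F \<subseteq> {1..p} \<and> indicator_exp F \<in> exponent_cone (b i) (snd (D ! i))} = {}"
      then have "C i j = 0" for j unfolding C_def by (intro card_eq_0_iff[THEN iffD2] disjI1) blast
      then show ?thesis by simp
    next
      fix X Y assume XY: "{F. F \<subseteq> {1..p} \<and> indicator_exp F \<in> exponent_cone (b i) (snd (D ! i))} = {X..Y}"
        "X \<subseteq> Y" "snd (D ! i) \<subseteq> Y" "Y \<subseteq> {1..p}"
      have finY: "finite Y" using XY(4) finite_subset by blast
      have "C i j = card {F \<in> {X..Y}. card F = j}" for j
        unfolding C_def XY(1)[symmetric] by (rule arg_cong[of _ _ card]) blast
      then have C: "C i j = (if card X \<le> j then (card Y - card X) choose (j - card X) else 0)" for j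
        using card_interval_of_card[OF finY XY(2)] by simp
      have "?d \<le> card Y" using le[OF i] card_mono[OF finY XY(3)] by simp
      then show ?thesis
        using alternating_binomial_sum_interval_nonneg[OF k, of "card Y" "card X"] card_mono[OF finY XY(2)]
        by (simp add: C if_distrib cong: if_cong)
    qed
    then have "0 \<le> (\<Sum>i<length D. \<Sum>j=0..k. (- 1) ^ (k - j) * int ((?d - j) choose (k - j)) * int (C i j))"
      by (rule sum_nonneg) simp
    also have "\<dots> = hd_beta p (monomial_span G :: 'k mpoly set) {0} ?d k"
      unfolding hd_beta_def alpha by (subst sum.swap) (simp add: sum_distrib_left)
    finally show ?thesis .
  qed
qed

lemma finite_hdepth_set: "finite {d. d \<le> p \<and> (\<forall>k\<le>d. 0 \<le> hd_beta p B A d k)}"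
  by (rule finite_subset[of _ "{..p}"]) auto

text \<open>\<open>Max\<close> is meaningful on finite nonempty sets only: the depths of all
  decompositions lie in the finite set defining \<open>hdepth\<close>, and \<open>D\<close>
  witnesses that there is one.\<close>

lemma sdepth_le_hdepth:
  fixes D :: "('k::field mpoly \<times> nat set) list"
  assumes D: "stanley_decomposition p (monomial_span G) D" and G: "G \<noteq> {}"
  shows "sdepth_decomp D \<le> sdepth p (monomial_span G :: 'k mpoly set)"
    "sdepth p (monomial_span G :: 'k mpoly set) \<le> hdepth p (monomial_span G :: 'k mpoly set) {0}"
proof -
  let ?M = "monomial_span G :: 'k mpoly set"
  let ?S = "{sdepth_decomp D |D. stanley_decomposition p ?M D}"
  have sub: "?S \<subseteq> {d. d \<le> p \<and> (\<forall>k\<le>d. 0 \<le> hd_beta p ?M {0} d k)}"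
    using sdepth_decomp_admissible[OF _ G] by blast
  have fin: "finite ?S" by (rule finite_subset[OF sub finite_hdepth_set])
  show "sdepth_decomp D \<le> sdepth p ?M"
    unfolding sdepth_def by (rule Max_ge[OF fin]) (use D in blast)
  show "sdepth p ?M \<le> hdepth p ?M {0}"
    unfolding sdepth_def hdepth_def by (rule Max_mono[OF sub _ finite_hdepth_set]) (use D in blast)
qed

section \<open>From interval partitions to Stanley decompositions\<close>

lemma exponent_cone_indicator_exp:
  assumes "finite X" "X \<subseteq> Y"
  shows "exponent_cone (indicator_exp X) Y = {a. Poly_Mapping.keys a \<in> {X..Y}}"
proof
  show "exponent_cone (indicator_exp X) Y \<subseteq> {a. Poly_Mapping.keys a \<in> {X..Y}}"
    using assms by (auto simp: exponent_cone_def keys_add_nat)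
  show "{a. Poly_Mapping.keys a \<in> {X..Y}} \<subseteq> exponent_cone (indicator_exp X) Y"
  proof
    fix a :: "nat \<Rightarrow>\<^sub>0 nat" assume a: "a \<in> {a. Poly_Mapping.keys a \<in> {X..Y}}"
    have eq: "a = (a - indicator_exp X) + indicator_exp X"
    proof (rule poly_mapping_eqI)
      fix i
      have "Poly_Mapping.lookup a i \<noteq> 0" if "i \<in> X" using that a by (auto simp: in_keys_iff)
      then show "Poly_Mapping.lookup a i = Poly_Mapping.lookup (a - indicator_exp X + indicator_exp X) i"
        using assms(1) by (auto simp: lookup_add lookup_minus lookup_indicator_exp)
    qed
    moreover have "Poly_Mapping.keys (a - indicator_exp X) \<subseteq> Poly_Mapping.keys a"
      by (auto simp: in_keys_iff lookup_minus)
    ultimately show "a \<in> exponent_cone (indicator_exp X) Y"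
      using a unfolding exponent_cone_def by fastforce
  qed
qed

text \<open>The interval from \<open>X\<close> to \<open>Y\<close> yields the summand x^X K[Y],
  which contains exactly the monomials with support in the interval. A partition of the supports
  therefore sorts all monomials, not just the squarefree ones.\<close>

lemma stanley_decomposition_of_interval_partition:
  assumes P: "interval_partition P \<S>" and sub: "\<S> \<subseteq> Pow {1..p}" and ne: "\<S> \<noteq> {}"
    and q: "\<And>X Y. (X, Y) \<in> P \<Longrightarrow> q \<le> card Y"
  obtains D :: "('k::field mpoly \<times> nat set) list"
  where "stanley_decomposition p (monomial_span {a. Poly_Mapping.keys a \<in> \<S>}) D" "q \<le> sdepth_decomp D"
proof -
  have XY: "X \<subseteq> Y" "Y \<subseteq> {1..p}" "finite X" "{X..Y} \<subseteq> \<S>" if "(X, Y) \<in> P" for X Y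
  proof -
    show 1: "X \<subseteq> Y" "{X..Y} \<subseteq> \<S>" and 2: "Y \<subseteq> {1..p}"
      using interval_partitionD[OF P that] sub by blast+
    show "finite X" using 1(1) 2 by (meson finite_atLeastAtMost finite_subset)
  qed
  have "P \<subseteq> Pow {1..p} \<times> Pow {1..p}"
  proof (rule subrelI)
    fix X Y assume "(X, Y) \<in> P"
    from XY(1,2)[OF this] show "(X, Y) \<in> Pow {1..p} \<times> Pow {1..p}" by blast
  qed
  then have "finite P" by (rule finite_subset) simp
  then obtain xs where xs: "set xs = P" "distinct xs" using finite_distinct_list by blast
  define D :: "('k mpoly \<times> nat set) list"
    where "D = map (\<lambda>(X, Y). (Poly_Mapping.single (indicator_exp X) 1, Y)) xs"
  have len: "length D = length xs" by (simp add: D_def)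
  have D: "fst (D ! i) = Poly_Mapping.single (indicator_exp (fst (xs ! i))) 1" "snd (D ! i) = snd (xs ! i)"
    if "i < length D" for i using that by (simp_all add: D_def split_beta)
  have xsP: "(fst (xs ! i), snd (xs ! i)) \<in> P" if "i < length D" for i
    using nth_mem[of i xs] that unfolding len xs(1) by simp
  have cone: "exponent_cone (indicator_exp (fst (xs ! i))) (snd (D ! i)) =
      {a. Poly_Mapping.keys a \<in> {fst (xs ! i)..snd (xs ! i)}}" if "i < length D" for i
    using D(2)[OF that] exponent_cone_indicator_exp XY(1,3)[OF xsP[OF that]] by simp
  have "stanley_decomposition p (monomial_span {a. Poly_Mapping.keys a \<in> \<S>}) D"
  proof (rule stanley_decompositionI[where b = "\<lambda>i. indicator_exp (fst (xs ! i))"])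
    show "fst (D ! i) = Poly_Mapping.single (indicator_exp (fst (xs ! i))) 1 \<and> snd (D ! i) \<subseteq> {1..p}"
      if "i < length D" for i using D[OF that] XY(2)[OF xsP[OF that]] by simp
    show "disjoint_family_on (\<lambda>i. exponent_cone (indicator_exp (fst (xs ! i))) (snd (D ! i))) {..<length D}"
      unfolding disjoint_family_on_def
    proof (intro ballI impI)
      fix i j assume ij: "i \<in> {..<length D}" "j \<in> {..<length D}" "i \<noteq> j"
      have "{fst (xs ! i)..snd (xs ! i)} \<inter> {fst (xs ! j)..snd (xs ! j)} = {}"
      proof (rule ccontr)
        assume "{fst (xs ! i)..snd (xs ! i)} \<inter> {fst (xs ! j)..snd (xs ! j)} \<noteq> {}"
        then obtain S where S: "S \<in> {fst (xs ! i)..snd (xs ! i)}" "S \<in> {fst (xs ! j)..snd (xs ! j)}" by blast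
        have "S \<in> \<S>" using S(1) XY(4)[OF xsP] ij by blast
        then have "xs ! i = xs ! j"
          using interval_partitionE[OF P] S xsP ij by (metis lessThan_iff prod.collapse)
        then show False using ij xs(2) by (simp add: len nth_eq_iff_index_eq)
      qed
      then show "exponent_cone (indicator_exp (fst (xs ! i))) (snd (D ! i)) \<inter>
          exponent_cone (indicator_exp (fst (xs ! j))) (snd (D ! j)) = {}"
        using cone ij by auto
    qed
    have "S \<in> \<S> \<longleftrightarrow> (\<exists>i<length D. S \<in> {fst (xs ! i)..snd (xs ! i)})" for S
    proof
      assume "S \<in> \<S>"
      then obtain X Y where "(X, Y) \<in> P" "S \<in> {X..Y}" using interval_partitionE[OF P] by metis
      then show "\<exists>i<length D. S \<in> {fst (xs ! i)..snd (xs ! i)}"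
        using xs(1) by (metis fst_conv in_set_conv_nth len snd_conv)
    qed (use XY(4)[OF xsP] in blast)
    then show "(\<Union>i<length D. exponent_cone (indicator_exp (fst (xs ! i))) (snd (D ! i))) =
        {a. Poly_Mapping.keys a \<in> \<S>}"
      using cone by auto
  qed
  moreover have "q \<le> sdepth_decomp D"
  proof -
    obtain S where "S \<in> \<S>" using ne by blast
    \<comment> \<open>Nonemptiness is what gives \<open>Min\<close> in \<open>sdepth_decomp\<close>
      its meaning.\<close>
    then have "P \<noteq> {}" using interval_partitionE[OF P] by blast
    then have "D \<noteq> []" using xs(1) by (auto simp: D_def)
    then show ?thesis
      unfolding sdepth_decomp_def using q xs(1) by (subst Min_ge_iff) (auto simp: D_def split_beta)
  qed
  ultimately show thesis by (rule that)
qed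

section \<open>The intersection of two prime monomial ideals\<close>

text \<open>Inclusion-exclusion over the subsets that lie in \<open>A\<close> or in
  \<open>B\<close>. Only the empty set lies in both; writing its count as \<open>0 choose j\<close>
  gives all four terms the same shape.\<close>

lemma card_subsets_meeting_both:
  assumes fin: "finite A" "finite B" and disj: "A \<inter> B = {}"
  shows "int (card {S. S \<subseteq> A \<union> B \<and> card S = j \<and> S \<inter> A \<noteq> {} \<and> S \<inter> B \<noteq> {}}) =
    int ((card A + card B) choose j) - int (card A choose j) - int (card B choose j) + int (0 choose j)"
proof -
  let ?T = "{S. S \<subseteq> A \<union> B \<and> card S = j \<and> S \<inter> A \<noteq> {} \<and> S \<inter> B \<noteq> {}}"
  let ?A = "{S. S \<subseteq> A \<and> card S = j}" and ?B = "{S. S \<subseteq> B \<and> card S = j}"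
  have finAB: "finite {S. S \<subseteq> A \<union> B \<and> card S = j}" using fin by simp
  have "card {S. S \<subseteq> A \<union> B \<and> card S = j} = card (?T \<union> (?A \<union> ?B))"
    by (rule arg_cong[of _ _ card]) blast
  also have "\<dots> = card ?T + card (?A \<union> ?B)"
    using fin disj by (intro card_Un_disjoint finite_subset[OF _ finAB]) blast+
  finally have 1: "(card A + card B) choose j = card ?T + card (?A \<union> ?B)"
    using fin disj by (simp add: n_subsets card_Un_disjoint)
  have 2: "card ?A + card ?B = card (?A \<union> ?B) + card (?A \<inter> ?B)"
    by (rule card_Un_Int) (use fin in simp_all)
  have "?A \<inter> ?B = {S. S \<subseteq> {} \<and> card S = j}" using disj by blast
  then have "card (?A \<inter> ?B) = 0 choose j" using n_subsets[of "{} :: 'a set" j] by simp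
  then show ?thesis using 1 2 fin by (simp add: n_subsets)
qed

section \<open>The ideal, its numbers beta and its depths\<close>

definition two_block_supports :: "nat \<Rightarrow> nat \<Rightarrow> nat set set" where
  "two_block_supports n m =
    {S. S \<subseteq> {1..n+m} \<and> S \<inter> {1..n} \<noteq> {} \<and> S \<inter> {n+1..n+m} \<noteq> {}}"

definition two_block_ideal :: "nat \<Rightarrow> nat \<Rightarrow> 'k::field mpoly set" where
  "two_block_ideal n m = monomial_span {a. Poly_Mapping.keys a \<in> two_block_supports n m}"

lemma two_block_ideal_eq:
  "Idl\<^bsub>poly_ring (n + m)\<^esub> (Var ` {1..n}) \<inter> Idl\<^bsub>poly_ring (n + m)\<^esub> (Var ` {n+1..n+m}) =
    (two_block_ideal n m :: 'k::field mpoly set)"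
proof -
  have "{1..n} \<subseteq> {1..n+m}" "{n+1..n+m} \<subseteq> {1..n+m}" by auto
  note * = this[THEN genideal_Var]
  show ?thesis
    unfolding * monomial_span_Int two_block_ideal_def two_block_supports_def
    by (rule arg_cong[of _ _ monomial_span]) blast
qed

text \<open>Each of the four binomials in \<open>card_subsets_meeting_both\<close> contributes one
  value of \<open>g\<close>; the value at 0 stems from the empty set.\<close>

lemma two_block_ideal_hd_beta:
  assumes "k \<le> d"
  defines "g \<equiv> \<lambda>a. (a - real d + real k - 1) gchoose k"
  shows "real_of_int (hd_beta (n + m) (two_block_ideal n m :: 'k::field mpoly set) {0} d k) =
    g (real (n + m)) - g (real n) - g (real m) + g 0"
proof -
  have un: "{1..n} \<union> {n+1..n+m} = {1..n+m}" by auto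
  have alpha: "real (hd_alpha (n + m) (two_block_ideal n m :: 'k mpoly set) {0} j) =
      real ((n + m) choose j) - real (n choose j) - real (m choose j) + real (0 choose j)" for j
  proof -
    have "{F. F \<subseteq> {1..n+m} \<and> card F = j \<and> Poly_Mapping.keys (indicator_exp F) \<in> two_block_supports n m} =
        {S. S \<subseteq> {1..n} \<union> {n+1..n+m} \<and> card S = j \<and> S \<inter> {1..n} \<noteq> {} \<and> S \<inter> {n+1..n+m} \<noteq> {}}"
      unfolding un
    proof (rule Collect_cong)
      fix F
      have "Poly_Mapping.keys (indicator_exp F) = F" if "F \<subseteq> {1..n+m}"
        using that finite_subset by (intro keys_indicator_exp) blast
      then show "F \<subseteq> {1..n+m} \<and> card F = j \<and> Poly_Mapping.keys (indicator_exp F) \<in> two_block_supports n m \<longleftrightarrow>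
          F \<subseteq> {1..n+m} \<and> card F = j \<and> F \<inter> {1..n} \<noteq> {} \<and> F \<inter> {n+1..n+m} \<noteq> {}"
        unfolding two_block_supports_def by (cases "F \<subseteq> {1..n+m}") simp_all
    qed
    then have "int (hd_alpha (n + m) (two_block_ideal n m :: 'k mpoly set) {0} j) =
        int ((n + m) choose j) - int (n choose j) - int (m choose j) + int (0 choose j)"
      unfolding two_block_ideal_def hd_alpha_monomial_span mem_Collect_eq
      using card_subsets_meeting_both[of "{1..n}" "{n+1..n+m}" j] by (simp only:) simp
    then show ?thesis by linarith
  qed
  let ?s = "\<lambda>a. \<Sum>j=0..k. (- 1) ^ (k - j) * real ((d - j) choose (k - j)) * real (a choose j)"
  have "real_of_int (hd_beta (n + m) (two_block_ideal n m :: 'k mpoly set) {0} d k) =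
      ?s (n + m) - ?s n - ?s m + ?s 0"
    unfolding hd_beta_def of_int_sum sum.distrib[symmetric] sum_subtractf[symmetric]
    by (rule sum.cong) (simp_all add: alpha right_diff_distrib distrib_left)
  also have "\<dots> = g (real (n + m)) - g (real n) - g (real m) + g 0"
    unfolding g_def by (simp only: alternating_binomial_sum[OF assms(1)] of_nat_0)
  finally show ?thesis .
qed

text \<open>A support meeting both blocks is a pair of nonempty subsets, so the product of the two
  partitions applies. The upper ends have at least half the size of their blocks, and
  \<open>(n + 1) div 2\<close> is this half rounded up.\<close>

lemma two_block_ideal_stanley_decomposition:
  assumes "1 \<le> n" "1 \<le> m"
  obtains D :: "('k::field mpoly \<times> nat set) list"
  where "stanley_decomposition (n + m) (two_block_ideal n m) D"
    "(n + 1) div 2 + (m + 1) div 2 \<le> sdepth_decomp D"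
proof -
  let ?A = "{1..n}" and ?B = "{n+1..n+m}"
  obtain P where P: "interval_partition P (Pow ?A - {{}})" "\<And>X Y. (X, Y) \<in> P \<Longrightarrow> n \<le> 2 * card Y"
    using nonempty_interval_partition[of ?A] by auto
  obtain Q where Q: "interval_partition Q (Pow ?B - {{}})" "\<And>X Y. (X, Y) \<in> Q \<Longrightarrow> m \<le> 2 * card Y"
    using nonempty_interval_partition[of ?B] by auto
  let ?R = "(\<lambda>((X, Y), (X', Y')). (X \<union> X', Y \<union> Y')) ` (P \<times> Q)"
  have un: "?A \<union> ?B = {1..n+m}" and disj: "?A \<inter> ?B = {}" by auto
  have "interval_partition ?R
      {S. S \<subseteq> ?A \<union> ?B \<and> S \<inter> ?A \<in> Pow ?A - {{}} \<and> S \<inter> ?B \<in> Pow ?B - {{}}}"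
    by (rule interval_partition_product[OF P(1) Q(1) _ _ disj]) auto
  also have "{S. S \<subseteq> ?A \<union> ?B \<and> S \<inter> ?A \<in> Pow ?A - {{}} \<and> S \<inter> ?B \<in> Pow ?B - {{}}} =
      two_block_supports n m"
    unfolding two_block_supports_def un by blast
  finally have R: "interval_partition ?R (two_block_supports n m)" .
  have sub: "two_block_supports n m \<subseteq> Pow {1..n+m}"
    unfolding two_block_supports_def by blast
  have "{1, n + 1} \<in> two_block_supports n m"
    using assms by (auto simp: two_block_supports_def)
  then have ne: "two_block_supports n m \<noteq> {}" by blast
  have card: "(n + 1) div 2 + (m + 1) div 2 \<le> card V" if "(U, V) \<in> ?R" for U V
  proof -
    obtain X Y X' Y' where XY: "(X, Y) \<in> P" "(X', Y') \<in> Q" "V = Y \<union> Y'" using \<open>(U, V) \<in> ?R\<close> by auto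
    have YA: "Y \<subseteq> ?A" "Y' \<subseteq> ?B"
      using interval_partitionD(3)[OF P(1) XY(1)] interval_partitionD(3)[OF Q(1) XY(2)] by blast+
    have "Y \<inter> Y' = {}" using YA disj by blast
    moreover have "finite Y" "finite Y'" using YA by (meson finite_atLeastAtMost finite_subset)+
    ultimately have "card V = card Y + card Y'" unfolding XY(3) by (simp add: card_Un_disjoint)
    moreover have "(n + 1) div 2 \<le> card Y" using P(2)[OF XY(1)] by linarith
    moreover have "(m + 1) div 2 \<le> card Y'" using Q(2)[OF XY(2)] by linarith
    ultimately show ?thesis by simp
  qed
  obtain D :: "('k mpoly \<times> nat set) list" where
    "stanley_decomposition (n + m) (monomial_span {a. Poly_Mapping.keys a \<in> two_block_supports n m}) D"
    "(n + 1) div 2 + (m + 1) div 2 \<le> sdepth_decomp D"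
    by (rule stanley_decomposition_of_interval_partition[OF R sub ne card]) blast
  then show thesis unfolding two_block_ideal_def[symmetric] by (rule that)
qed

lemma two_block_ideal_sdepth:
  assumes "1 \<le> n" "1 \<le> m"
  shows "(n + 1) div 2 + (m + 1) div 2 \<le> sdepth (n + m) (two_block_ideal n m :: 'k::field mpoly set)"
    "sdepth (n + m) (two_block_ideal n m :: 'k mpoly set) \<le>
      hdepth (n + m) (two_block_ideal n m :: 'k mpoly set) {0}"
proof -
  obtain D :: "('k mpoly \<times> nat set) list" where
    D: "stanley_decomposition (n + m) (two_block_ideal n m) D"
      "(n + 1) div 2 + (m + 1) div 2 \<le> sdepth_decomp D"
    by (rule two_block_ideal_stanley_decomposition[OF assms])
  have "{1, n + 1} \<in> two_block_supports n m"
    using assms by (auto simp: two_block_supports_def)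
  then have "indicator_exp {1, n + 1} \<in> {a. Poly_Mapping.keys a \<in> two_block_supports n m}"
    by simp
  then have ne: "{a :: nat \<Rightarrow>\<^sub>0 nat. Poly_Mapping.keys a \<in> two_block_supports n m} \<noteq> {}" by blast
  note * = sdepth_le_hdepth[OF D(1)[unfolded two_block_ideal_def] ne, folded two_block_ideal_def]
  show "(n + 1) div 2 + (m + 1) div 2 \<le> sdepth (n + m) (two_block_ideal n m :: 'k mpoly set)"
    by (rule order_trans[OF D(2) *(1)])
  show "sdepth (n + m) (two_block_ideal n m :: 'k mpoly set) \<le>
      hdepth (n + m) (two_block_ideal n m :: 'k mpoly set) {0}"
    by (rule *(2))
qed

text \<open>The upper bound comes from k = 3. For the lower bound, the Stanley decomposition reaches
  the value unless \<open>n\<close> and \<open>m\<close> are both even; then it falls short by one,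
  and nonnegativity at d = t+s+1 is checked directly.\<close>

lemma two_block_ideal_hdepth:
  assumes nm: "m \<le> n" "1 \<le> m"
  shows "hdepth (n + m) (two_block_ideal n m :: 'k::field mpoly set) {0} = (n + m + 2) div 2"
proof (rule antisym)
  let ?I = "two_block_ideal n m :: 'k mpoly set"
  let ?S = "{d. d \<le> n + m \<and> (\<forall>k\<le>d. 0 \<le> hd_beta (n + m) ?I {0} d k)}"
  let ?h = "hdepth (n + m) ?I {0}"
  \<comment> \<open>This puts the maximum into the set, so its defining inequalities are available
    at \<open>?h\<close>.\<close>
  have "0 \<in> ?S" by (simp add: hd_beta_def)
  then have h: "?h \<in> ?S"
    unfolding hdepth_def using Max_in[OF finite_hdepth_set] by blast
  show "?h \<le> (n + m + 2) div 2"
  \<comment> \<open>The inequality for k = 3 is available only for depth at least 3. A smaller depth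
    is within the bound, which is at least 2 because both blocks are nonempty.\<close>
  proof (cases "3 \<le> ?h")
    case True
    have "0 \<le> real_of_int (hd_beta (n + m) ?I {0} ?h 3)" using h True by simp
    also have "\<dots> = real n * real m * (real n + real m + 2 - 2 * real ?h) / 2"
      unfolding two_block_ideal_hd_beta[OF True] of_nat_add
      using mixed_difference_gbinomial_3[of "real n" "real m" "real ?h"] by simp
    finally have "0 \<le> real n * real m * (real n + real m + 2 - 2 * real ?h)" by simp
    moreover have "0 < real n * real m" using nm by simp
    ultimately have "0 \<le> real n + real m + 2 - 2 * real ?h"
      using mult_pos_neg[of "real n * real m" "real n + real m + 2 - 2 * real ?h"] by linarith
    then have "2 * ?h \<le> n + m + 2" by linarith
    then show ?thesis by linarith
  qed (use nm in simp)
  show "(n + m + 2) div 2 \<le> ?h"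
  proof (cases "even n \<and> even m")
    case True
    then obtain t s where ts: "n = 2 * t" "m = 2 * s" by (auto elim!: evenE)
    have "0 \<le> hd_beta (n + m) ?I {0} (t + s + 1) k" if "k \<le> t + s + 1" for k
    proof -
      have "0 \<le> real_of_int (hd_beta (n + m) ?I {0} (t + s + 1) k)"
        unfolding two_block_ideal_hd_beta[OF that] unfolding ts
        using nm ts that by (intro mixed_difference_gbinomial_nonneg) auto
      then show ?thesis by simp
    qed
    then have "t + s + 1 \<in> ?S" using nm ts by simp
    then have "t + s + 1 \<le> ?h" unfolding hdepth_def by (rule Max_ge[OF finite_hdepth_set])
    then show ?thesis using ts by simp
  next
    case False
    then have "(n + m + 2) div 2 = (n + 1) div 2 + (m + 1) div 2" by presburger
    also have "\<dots> \<le> ?h"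
      using two_block_ideal_sdepth[of n m, where ?'k = 'k] nm by linarith
    finally show ?thesis .
  qed
qed

lemma ceiling_half: "\<lceil>real n / 2\<rceil> = int ((n + 1) div 2)"
proof (rule ceiling_unique)
  show "real_of_int (int ((n + 1) div 2)) - 1 < real n / 2"
    "real n / 2 \<le> real_of_int (int ((n + 1) div 2))" by linarith+
qed

theorem theorem2p9:
  fixes n m :: nat and I :: "'k::field mpoly set"
  assumes "n \<ge> m" and "m \<ge> 1"
    and "I = Idl\<^bsub>poly_ring (n + m)\<^esub> (Var ` {1..n}) \<inter> Idl\<^bsub>poly_ring (n + m)\<^esub> (Var ` {n+1..n+m})"
  shows "(\<not> (even n \<and> even m) \<longrightarrow>
           sdepth (n + m) I = hdepth (n + m) I {0} \<and>
           int (hdepth (n + m) I {0}) = \<lceil>real n / 2\<rceil> + \<lceil>real m / 2\<rceil>) \<and>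
         (\<forall>t s :: int. int n = 2 * t \<and> int m = 2 * s \<longrightarrow>
           t + s \<le> int (sdepth (n + m) I) \<and>
           sdepth (n + m) I \<le> hdepth (n + m) I {0} \<and>
           int (hdepth (n + m) I {0}) \<le> t + s + 1) \<and>
         int (hdepth (n + m) I {0}) = \<lfloor>real (n + m + 2) / 2\<rfloor>"
proof -
  have I: "I = two_block_ideal n m"
    using assms(3) unfolding two_block_ideal_eq .
  have h: "hdepth (n + m) I {0} = (n + m + 2) div 2"
    unfolding I by (rule two_block_ideal_hdepth[OF assms(1,2)])
  have s: "(n + 1) div 2 + (m + 1) div 2 \<le> sdepth (n + m) I" "sdepth (n + m) I \<le> (n + m + 2) div 2"
    unfolding h[symmetric] unfolding I using two_block_ideal_sdepth[of n m] assms(1,2) by simp_all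
  have odd: "(n + m + 2) div 2 = (n + 1) div 2 + (m + 1) div 2" if "\<not> (even n \<and> even m)"
    using that by presburger
  have floor: "\<lfloor>real (n + m + 2) / 2\<rfloor> = int ((n + m + 2) div 2)"
    using floor_divide_of_nat_eq[of "n + m + 2" 2] by simp
  \<comment> \<open>The two bounds in \<open>s\<close> coincide by \<open>odd\<close> unless both
    numbers are even, where they are t+s and t+s+1.\<close>
  show ?thesis
    unfolding h floor ceiling_half using s odd by (intro conjI impI allI) linarith+
qed

end
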